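(* Suppose conditions C1, C2, C3 and C4 (stated in the context) hold, with $\tau$ the exponent in C1 and $\kappa$ the exponent in C3. Let $0<\beta<1/2-\kappa$ and $\alpha=\min\{1-2\beta+\tau,\ \beta+\tau,\ 1\}$, and suppose that $$\frac{K_n\log n}{n^\alpha}=o(1)\quad\text{and}\quad\frac{K_n\log p}{n^\alpha}=o(1).$$ Then $$\liminf_{n\to\infty}\Big\{\min_{l\in\mathcal A}\hat\rho_l-\max_{l\in\mathcal I}\hat\rho_l\Big\}\ge0\quad\text{almost surely}.$$
   Context: Setting. $Y$ is a categorical random variable taking values $L_1,\dots,L_K$, $K\ge2$, with $p_k=P(Y=L_k)>0$. $\boldsymbol X=(X_1,\dots,X_p)^T$ is a random vector in $\mathbb R^p$ whose coordinates are partitioned into $r$ groups $\boldsymbol X_{(1)},\dots,\boldsymbol X_{(r)}$, where $\boldsymbol X_{(l)}=(X_{l1},\dots,X_{lq_l})^T\in\mathbb R^{q_l}$, $q_1+\cdots+q_r=p$, and the $q_l$ are finite. $n$ denotes the sample size; $p$, $r$ and the number of classes $K=K_n$ may depend on $n$. $\|\cdot\|$ is the Euclidean norm. Asymptotic notation is as $n\to\infty$. Gini distance correlation. Let $F_l$ be the distribution of $\boldsymbol X_{(l)}$ and $F_{l|k}$ the conditional distribution of $\boldsymbol X_{(l)}$ given $Y=L_k$; $\boldsymbol X_{(l|k)}$ denotes a random vector with distribution $F_{l|k}$. Let $\Delta_l=\mathbb E\|\boldsymbol X_{(l)1}-\boldsymbol X_{(l)2}\|$ with $\boldsymbol X_{(l)1},\boldsymbol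 X_{(l)2}$ i.i.d. from $F_l$, and $\Delta_{l|k}=\mathbb E\|\boldsymbol X_{(l|k)1}-\boldsymbol X_{(l|k)2}\|$ with $\boldsymbol X_{(l|k)1},\boldsymbol X_{(l|k)2}$ i.i.d. from $F_{l|k}$. The Gini distance correlation between $\boldsymbol X_{(l)}$ and $Y$ is $$\rho_l=\frac{\Delta_l-\sum_{k=1}^Kp_k\Delta_{l|k}}{\Delta_l}.$$ Estimator. Let $(\boldsymbol X_1,Y_1),\dots,(\boldsymbol X_n,Y_n)$ be an i.i.d. sample from the joint distribution of $(\boldsymbol X,Y)$; $\boldsymbol X_{(l)i}$ is the $l$-th group of $\boldsymbol X_i$. Let $n_k=\sum_{i=1}^n\mathbf 1(Y_i=L_k)$, $\hat p_k=n_k/n$, and let $\boldsymbol X_{(l|k)1},\dots,\boldsymbol X_{(l|k)n_k}$ be the sample values $\boldsymbol X_{(l)i}$ with $Y_i=L_k$. Then $$\hat\rho_l=\frac{\binom n2^{-1}\sum_{1\le i<j\le n}\|\boldsymbol X_{(l)i}-\boldsymbol X_{(l)j}\|-\sum_{k=1}^K\hat p_k\binom{n_k}2^{-1}\sum_{1\le i<j\le n_k}\|\boldsymbol X_{(l|k)i}-\boldsymbol X_{(l|k)j}\|}{\binom n2^{-1}\sum_{1\le i<j\le n}\|\boldsymbol X_{(l)i}-\boldsymbol X_{(l)j}\|}.$$ Active and inactive sets. Let $G(Y=L_k|\boldsymbol X)$ denote the conditional distribution of $Y$ given $\boldsymbol X$. Put $\mathcal A=\{l: G(Y=L_k|\boldsymbol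 X)\text{ functionally depends on }\boldsymbol X_{(l)}\text{ for some }k\}$ and $\mathcal I=\{l: G(Y=L_k|\boldsymbol X)\text{ does not functionally depend on }\boldsymbol X_{(l)}\text{ for all }k\}$, i.e. $\mathcal I$ is the complement of $\mathcal A$ in $\{1,\dots,r\}$. Conditions. C1: there exist positive constants $c_1,c_2$ such that $c_1/K_n\le\min_{1\le k\le K_n}p_k\le\max_{1\le k\le K_n}p_k\le c_2/K_n$, and $K_n=O(n^\tau)$ for some $\tau\ge0$. C2: there exists a positive constant $s_0$ such that for all $0\le s\le2s_0$, $\sup_r\max_{1\le l\le r}\sup_K\max_{1\le k\le K}\mathbb E\{\exp(s\|\boldsymbol X_{(l|k)}\|)\}<\infty$. C3: $\min_{l\in\mathcal A}\rho_l\ge2c\,n^{-\kappa}$, for some constants $c>0$ and $0\le\kappa<1/2$. C4: for some positive constant $c_3$, $\liminf_{r\to\infty}\{\min_{l\in\mathcal A}\rho_l-\max_{l\in\mathcal I}\rho_l\}\ge c_3$.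
   Formalization: The formal theorem additionally assumes that the Gini mean differences Δ_l are bounded below by a positive constant, uniformly in n and l; without it the claim fails when some Δ_l tends to 0 like 1/n. *)

theory Defs
  imports "HOL-Probability.Probability" "HOL-Library.Landau_Symbols"
begin

text \<open>
  A vector in \<open>\<real>\<^sup>p\<close> is an extensional function on \<open>{..<p}\<close>, a group of coordinates is a set
  \<open>I \<subseteq> {..<p}\<close>, and the subvector of that group is the restriction to \<open>I\<close>, with Euclidean norm
  \<open>L2_set _ I\<close>. The class labels \<open>L\<^sub>1, \<dots>, L\<^sub>K\<close> form a finite set \<open>C\<close> with \<open>card C = K\<close>; a class
  is referred to by its label \<open>k \<in> C\<close>.
\<close>

abbreviation vec_space :: "nat set \<Rightarrow> (nat \<Rightarrow> real) measure" where
  "vec_space I \<equiv> (\<Pi>\<^sub>M j\<in>I. borel)"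

abbreviation obs_space :: "nat \<Rightarrow> 'c set \<Rightarrow> ((nat \<Rightarrow> real) \<times> 'c) measure" where
  "obs_space p C \<equiv> vec_space {..<p} \<Otimes>\<^sub>M count_space C"

text \<open>In the following, \<open>D\<close> is the joint law of \<open>(X, Y)\<close>, a measure on \<open>obs_space p C\<close>.\<close>

definition class_event :: "((nat \<Rightarrow> real) \<times> 'c) measure \<Rightarrow> 'c \<Rightarrow> ((nat \<Rightarrow> real) \<times> 'c) set" where
  "class_event D k = {z \<in> space D. snd z = k}"

definition class_prob :: "((nat \<Rightarrow> real) \<times> 'c) measure \<Rightarrow> 'c \<Rightarrow> real" where
  "class_prob D k = measure D (class_event D k)"

definition group_law ::
  "((nat \<Rightarrow> real) \<times> 'c) measure \<Rightarrow> nat set \<Rightarrow> (nat \<Rightarrow> real) measure" where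
  "group_law D I = distr D (vec_space I) (\<lambda>z. restrict (fst z) I)"

definition cond_group_law ::
  "((nat \<Rightarrow> real) \<times> 'c) measure \<Rightarrow> nat set \<Rightarrow> 'c \<Rightarrow> (nat \<Rightarrow> real) measure" where
  "cond_group_law D I k = group_law (uniform_measure D (class_event D k)) I"

definition gini_mean_diff :: "nat set \<Rightarrow> (nat \<Rightarrow> real) measure \<Rightarrow> real" where
  "gini_mean_diff I F = (\<integral>z. L2_set (\<lambda>j. fst z j - snd z j) I \<partial>(F \<Otimes>\<^sub>M F))"

definition gini_dcor :: "'c set \<Rightarrow> ((nat \<Rightarrow> real) \<times> 'c) measure \<Rightarrow> nat set \<Rightarrow> real" where
  "gini_dcor C D I =
     (gini_mean_diff I (group_law D I)
        - (\<Sum>k\<in>C. class_prob D k * gini_mean_diff I (cond_group_law D I k)))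
     / gini_mean_diff I (group_law D I)"

text \<open>
  The sample version of \<open>gini_mean_diff\<close> over the observations with index in \<open>S\<close>. The class
  sample of class \<open>k\<close> is given by its set of indices, not renumbered from 1. A class with fewer
  than two observations contributes \<open>0\<close>, and the estimator is \<open>0\<close> if its denominator vanishes
  (division by zero).
\<close>

definition gini_mean_diff_hat :: "nat set \<Rightarrow> nat set \<Rightarrow> (nat \<Rightarrow> nat \<Rightarrow> real) \<Rightarrow> real" where
  "gini_mean_diff_hat I S x =
     (\<Sum>i\<in>S. \<Sum>j | j \<in> S \<and> i < j. L2_set (\<lambda>c. x i c - x j c) I) / real (card S choose 2)"

definition gini_dcor_hat ::
  "'c set \<Rightarrow> nat \<Rightarrow> (nat \<Rightarrow> nat \<Rightarrow> real) \<Rightarrow> (nat \<Rightarrow> 'c) \<Rightarrow> nat set \<Rightarrow> real" where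
  "gini_dcor_hat C n x y I =
     (gini_mean_diff_hat I {..<n} x
        - (\<Sum>k\<in>C. real (card {i. i < n \<and> y i = k}) / real n
                 * gini_mean_diff_hat I {i. i < n \<and> y i = k} x))
     / gini_mean_diff_hat I {..<n} x"

text \<open>\<open>g\<close> is a version of \<open>x \<mapsto> P(Y = k | X = x)\<close>.\<close>

definition cond_prob_version ::
  "nat \<Rightarrow> ((nat \<Rightarrow> real) \<times> 'c) measure \<Rightarrow> 'c \<Rightarrow> ((nat \<Rightarrow> real) \<Rightarrow> real) \<Rightarrow> bool" where
  "cond_prob_version p D k g \<longleftrightarrow>
     g \<in> borel_measurable (vec_space {..<p}) \<and>
     (AE z in D. real_cond_exp D (vimage_algebra (space D) fst (vec_space {..<p}))
                   (indicator (class_event D k)) z = g (fst z))"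

text \<open>
  A conditional probability is determined only up to null sets, so it depends functionally on a
  group iff none of its versions is constant in the coordinates of that group.
\<close>

definition depends_on_group ::
  "nat \<Rightarrow> ((nat \<Rightarrow> real) \<times> 'c) measure \<Rightarrow> 'c \<Rightarrow> nat set \<Rightarrow> bool" where
  "depends_on_group p D k I \<longleftrightarrow>
     \<not> (\<exists>g. cond_prob_version p D k g \<and>
            (\<forall>x \<in> space (vec_space {..<p}). \<forall>x' \<in> space (vec_space {..<p}).
               (\<forall>j \<in> {..<p} - I. x j = x' j) \<longrightarrow> g x = g x'))"

definition active_set ::
  "nat \<Rightarrow> nat \<Rightarrow> 'c set \<Rightarrow> (nat \<Rightarrow> nat set) \<Rightarrow> ((nat \<Rightarrow> real) \<times> 'c) measure \<Rightarrow> nat set" where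
  "active_set p r C G D = {l. l < r \<and> (\<exists>k\<in>C. depends_on_group p D k (G l))}"

definition inactive_set ::
  "nat \<Rightarrow> nat \<Rightarrow> 'c set \<Rightarrow> (nat \<Rightarrow> nat set) \<Rightarrow> ((nat \<Rightarrow> real) \<times> 'c) measure \<Rightarrow> nat set" where
  "inactive_set p r C G D = {l. l < r \<and> (\<forall>k\<in>C. \<not> depends_on_group p D k (G l))}"

text \<open>
  \<open>min\<^bsub>l\<in>A\<^esub> f l - max\<^bsub>l\<in>B\<^esub> f l\<close> for finite index sets, with \<open>min \<emptyset> = \<infinity>\<close> and \<open>max \<emptyset> = -\<infinity>\<close>.
\<close>

definition gap :: "nat set \<Rightarrow> nat set \<Rightarrow> (nat \<Rightarrow> real) \<Rightarrow> ereal" where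
  "gap A B f = (INF l\<in>A. ereal (f l)) - (SUP l\<in>B. ereal (f l))"

end

theory Submission imports Defs begin

text \<open>
  Since \<open>\<alpha> \<le> 1\<close>, the rate conditions give \<open>K log n = o(n)\<close> and \<open>K log p = o(n)\<close>. Fix an event \<open>A\<close>
  (a class, or the whole space) of probability \<open>q\<close>, let \<open>d\<close> be the distance of two observations in
  one group, \<open>g x = E[d(x, X) | A]\<close> and \<open>\<Delta> = E[g X | A]\<close>. The U-statistic over the observations in
  \<open>A\<close>, minus \<open>\<Delta>\<close>, is a combination of the sums \<open>\<Sum>\<^sub>j 1\<^sub>A(X\<^sub>j) (d(X\<^sub>i, X\<^sub>j) - g X\<^sub>i)\<close> and
  \<open>\<Sum>\<^sub>j 1\<^sub>A(X\<^sub>j) (g X\<^sub>j - \<Delta>)\<close>. Given \<open>X\<^sub>i\<close>, both are sums of independent centered terms, and by the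
  triangle inequality the terms are bounded by \<open>\<parallel>X\<^sub>j\<parallel> + E[\<parallel>X\<parallel> | A]\<close> whatever \<open>X\<^sub>i\<close> is. So a Chernoff
  bound with exponent of order \<open>n q\<close> holds without conditioning on the class labels. The class
  probabilities are at least \<open>c\<^sub>1 / K\<close>, so the union bound over groups, classes and \<open>i\<close> is at most
  \<open>n powr -2\<close> eventually, and by Borel-Cantelli all sample correlations are almost surely within a
  fixed fraction of \<open>c\<^sub>3\<close> of the true ones from some \<open>n\<close> on.
\<close>

subsection \<open>Chernoff bounds in product spaces\<close>

text \<open>Second-order Taylor expansion with Lagrange remainder
  \<open>exp u / 2 * t\<^sup>2\<close> at an intermediate point; the factor 1/2 is given
  away.\<close>

lemma exp_le_quadratic: "exp t \<le> 1 + t + t\<^sup>2 * exp \<bar>t\<bar>" for t :: real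
proof -
  obtain u where u: "\<bar>u\<bar> \<le> \<bar>t\<bar>" "exp t = (\<Sum>m<2. t ^ m / fact m) + exp u / fact 2 * t ^ 2"
    using Maclaurin_exp_le[of t 2] by blast
  have "exp u * t\<^sup>2 / 2 \<le> exp \<bar>t\<bar> * t\<^sup>2 / 2"
    using u(1) by (intro divide_right_mono mult_right_mono) auto
  also have "\<dots> \<le> exp \<bar>t\<bar> * t\<^sup>2" by simp
  finally show ?thesis using u(2) by (simp add: lessThan_nat_numeral mult.commute)
qed

text \<open>The mean zero removes the linear term of the expansion. Because
  \<open>\<bar>t\<bar> \<le> s / 2\<close>, the exponential in the remainder costs only half of the
  available exponential moment of \<open>w\<close>, and the other half absorbs the square.\<close>

lemma (in prob_space) nn_integral_exp_le_quadratic: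
  assumes [measurable]: "f \<in> borel_measurable M" and int: "integrable M f"
    and zero: "expectation f = 0"
    and s: "0 < s" "\<bar>t\<bar> \<le> s / 2"
    and bound: "\<And>x. x \<in> space M \<Longrightarrow> \<bar>f x\<bar> \<le> w x"
    and [measurable]: "w \<in> borel_measurable M"
    and mgf: "(\<integral>\<^sup>+x. ennreal (exp (s * w x)) \<partial>M) \<le> ennreal b" and b: "0 \<le> b"
  shows "(\<integral>\<^sup>+x. ennreal (exp (t * f x)) \<partial>M) \<le> ennreal (1 + 8 * b / s\<^sup>2 * t\<^sup>2)"
proof -
  have intw: "integrable M (\<lambda>x. exp (s * w x))"
    by (rule integrableI_bounded) (use mgf in \<open>auto simp: less_top[symmetric] top_unique\<close>)
  have lew: "expectation (\<lambda>x. exp (s * w x)) \<le> b"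
    using mgf b nn_integral_eq_integral[OF intw] by (simp add: integral_nonneg_AE)
  have pt: "exp (t * f x) \<le> 1 + t * f x + (8 / s\<^sup>2 * t\<^sup>2) * exp (s * w x)" if "x \<in> space M" for x
  proof -
    have fw: "\<bar>f x\<bar> \<le> w x" and w0: "0 \<le> w x" using bound[OF that] by auto
    have tf: "\<bar>t * f x\<bar> \<le> s / 2 * w x"
      using mult_mono[OF s(2) fw] s by (simp add: abs_mult)
    \<comment> \<open>The constant 8 comes from \<open>y\<^sup>2 / 2 \<le> exp y\<close> at
      \<open>y = s / 2 * w x\<close>.\<close>
    have sq: "(w x)\<^sup>2 \<le> 8 / s\<^sup>2 * exp (s / 2 * w x)"
    proof -
      have "(s / 2 * w x)\<^sup>2 / 2 \<le> exp (s / 2 * w x)"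
        using exp_lower_Taylor_quadratic[of "s / 2 * w x"] w0 s(1) mult_nonneg_nonneg[of "s/2" "w x"] by linarith
      then show ?thesis using s(1) by (simp add: field_simps power2_eq_square)
    qed
    have "(t * f x)\<^sup>2 * exp \<bar>t * f x\<bar> \<le> (t\<^sup>2 * (w x)\<^sup>2) * exp (s / 2 * w x)"
      using fw tf w0 by (intro mult_mono) (auto simp: power_mult_distrib intro!: mult_left_mono simp flip: abs_le_square_iff)
    also have "\<dots> \<le> (t\<^sup>2 * (8 / s\<^sup>2 * exp (s / 2 * w x))) * exp (s / 2 * w x)"
      using sq by (intro mult_right_mono mult_left_mono) auto
    also have "\<dots> = (8 / s\<^sup>2 * t\<^sup>2) * exp (s * w x)"
      by (simp add: mult_exp_exp)
    finally show ?thesis using exp_le_quadratic[of "t * f x"] by linarith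
  qed
  have intR: "integrable M (\<lambda>x. 1 + t * f x + (8 / s\<^sup>2 * t\<^sup>2) * exp (s * w x))"
    using int intw by simp
  have "(\<integral>\<^sup>+x. ennreal (exp (t * f x)) \<partial>M)
      \<le> (\<integral>\<^sup>+x. ennreal (1 + t * f x + (8 / s\<^sup>2 * t\<^sup>2) * exp (s * w x)) \<partial>M)"
    by (intro nn_integral_mono ennreal_leI pt)
  also have "\<dots> = ennreal (expectation (\<lambda>x. 1 + t * f x + (8 / s\<^sup>2 * t\<^sup>2) * exp (s * w x)))"
    by (intro nn_integral_eq_integral[OF intR] AE_I2) (use pt order_trans[OF exp_ge_zero] in blast)
  also have "expectation (\<lambda>x. 1 + t * f x + (8 / s\<^sup>2 * t\<^sup>2) * exp (s * w x))
      = 1 + (8 / s\<^sup>2 * t\<^sup>2) * expectation (\<lambda>x. exp (s * w x))"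
    using int intw zero by (simp add: prob_space)
  also have "ennreal \<dots> \<le> ennreal (1 + 8 * b / s\<^sup>2 * t\<^sup>2)"
    using mult_left_mono[OF lew, of "8 / s\<^sup>2 * t\<^sup>2"] by (intro ennreal_leI) (simp add: mult_ac)
  finally show ?thesis .
qed

text \<open>Off \<open>A\<close> the integrand is 1, so the integral is at most
  \<open>(1 + a) * prob A + (1 - prob A) = 1 + a * prob A\<close>. In this way the probability of a
  class enters the Chernoff exponent. The bound \<open>- 1 \<le> a\<close> keeps
  \<open>ennreal (1 + a)\<close> from truncating.\<close>

lemma (in prob_space) nn_integral_uniform_measure_exp:
  assumes [measurable]: "A \<in> events" "f \<in> borel_measurable M" and "prob A > 0"
    and "(\<integral>\<^sup>+x. ennreal (exp (f x)) \<partial>uniform_measure M A) \<le> ennreal (1 + a)" and a: "- 1 \<le> a"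
  shows "(\<integral>\<^sup>+x. ennreal (exp (indicator A x * f x)) \<partial>M) \<le> ennreal (exp (a * prob A))"
proof -
  have e: "emeasure M A = ennreal (prob A)" by (simp add: emeasure_eq_measure)
  let ?I = "\<integral>\<^sup>+x. ennreal (exp (f x)) * indicator A x \<partial>M"
  have "?I = ?I / emeasure M A * emeasure M A"
    using assms(3) e by (simp add: ennreal_divide_times ennreal_divide_self)
  also have "?I / emeasure M A \<le> ennreal (1 + a)"
    using assms(4) by (subst (asm) nn_integral_uniform_measure) auto
  finally have I: "?I \<le> ennreal ((1 + a) * prob A)"
    using a by (simp add: e ennreal_mult mult_right_mono)
  have "(\<integral>\<^sup>+x. ennreal (exp (indicator A x * f x)) \<partial>M)
      = (\<integral>\<^sup>+x. ennreal (exp (f x)) * indicator A x + indicator (space M - A) x \<partial>M)"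
    by (intro nn_integral_cong) (auto simp: indicator_def)
  also have "\<dots> = ?I + emeasure M (space M - A)"
    by (subst nn_integral_add) auto
  also have "\<dots> \<le> ennreal ((1 + a) * prob A) + ennreal (1 - prob A)"
    using I by (intro add_mono) (auto simp: emeasure_eq_measure prob_compl)
  also have "\<dots> = ennreal (1 + a * prob A)"
    using a using mult_right_mono[of 0 "1 + a" "prob A"] by (subst ennreal_plus[symmetric]) (auto simp: algebra_simps)
  also have "\<dots> \<le> ennreal (exp (a * prob A))"
    by (intro ennreal_leI exp_ge_add_one_self)
  finally show ?thesis .
qed

text \<open>Exponential Markov inequality for the sum and for its negative, with the moment
  generating function factoring over the product. \<open>J\<close> may have fewer than
  \<open>n\<close> elements because it is used with one index removed.\<close>

lemma (in prob_space) PiM_chernoff: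
  assumes [measurable]: "f \<in> borel_measurable M" and J: "finite J" "card J \<le> n"
    and mgf: "\<And>u. u = t \<or> u = - t \<Longrightarrow>
       (\<integral>\<^sup>+x. ennreal (exp (u * f x)) \<partial>M) \<le> ennreal (exp (a * u\<^sup>2))"
    and a: "0 \<le> a" and t: "0 < t"
  shows "emeasure (PiM J (\<lambda>_. M)) {x \<in> space (PiM J (\<lambda>_. M)). \<bar>\<Sum>j\<in>J. f (x j)\<bar> > y}
    \<le> ennreal (2 * exp (a * real n * t\<^sup>2 - t * y))"
proof -
  interpret P: product_prob_space "\<lambda>_. M" J by unfold_locales
  let ?P = "PiM J (\<lambda>_. M)"
  have one: "emeasure ?P {x \<in> space ?P. u * (\<Sum>j\<in>J. f (x j)) > t * y} \<le> ennreal (exp (a * real n * t\<^sup>2 - t * y))"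
    if u: "u = t \<or> u = - t" for u
  proof -
    have "emeasure ?P {x \<in> space ?P. u * (\<Sum>j\<in>J. f (x j)) > t * y}
        = (\<integral>\<^sup>+x. indicator {x \<in> space ?P. u * (\<Sum>j\<in>J. f (x j)) > t * y} x \<partial>?P)"
      by (rule nn_integral_indicator[symmetric]) measurable
    also have "\<dots> \<le> (\<integral>\<^sup>+x. ennreal (exp (- (t * y))) * (\<Prod>j\<in>J. ennreal (exp (u * f (x j)))) \<partial>?P)"
    proof (intro nn_integral_mono)
      fix x assume "x \<in> space ?P"
      have "indicator {x \<in> space ?P. u * (\<Sum>j\<in>J. f (x j)) > t * y} x
           \<le> ennreal (exp (- (t * y) + u * (\<Sum>j\<in>J. f (x j))))"
        by (auto simp: indicator_def simp flip: ennreal_1 intro!: ennreal_leI)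
      also have "\<dots> = ennreal (exp (- (t * y))) * (\<Prod>j\<in>J. ennreal (exp (u * f (x j))))"
        by (simp add: exp_add[of "- (t * y)"] ennreal_mult prod_ennreal sum_distrib_left exp_sum J(1) prod_nonneg del: exp_minus add_uminus_conv_diff uminus_add_conv_diff)
      finally show "indicator {x \<in> space ?P. u * (\<Sum>j\<in>J. f (x j)) > t * y} x \<le> \<dots>" .
    qed
    also have "\<dots> = ennreal (exp (- (t * y))) * (\<integral>\<^sup>+x. (\<Prod>j\<in>J. ennreal (exp (u * f (x j)))) \<partial>?P)"
      by (rule nn_integral_cmult) measurable
    also have "(\<integral>\<^sup>+x. (\<Prod>j\<in>J. ennreal (exp (u * f (x j)))) \<partial>?P)
        = (\<Prod>j\<in>J. (\<integral>\<^sup>+x. ennreal (exp (u * f x)) \<partial>M))"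
      by (rule P.product_nn_integral_prod) (use J in auto)
    also have "ennreal (exp (- (t * y))) * \<dots> \<le> ennreal (exp (- (t * y))) * (\<Prod>j\<in>J. ennreal (exp (a * u\<^sup>2)))"
      by (intro mult_left_mono prod_mono) (use mgf[OF u] in \<open>auto intro!: power_mono\<close>)
    also have "\<dots> = ennreal (exp (- (t * y)) * exp (a * u\<^sup>2) ^ card J)"
      by (simp add: prod_ennreal ennreal_mult ennreal_power)
    also have "\<dots> \<le> ennreal (exp (a * real n * t\<^sup>2 - t * y))"
    proof (rule ennreal_leI)
      have "exp (- (t * y)) * exp (a * u\<^sup>2) ^ card J = exp (real (card J) * (a * t\<^sup>2) - t * y)"
        using u by (auto simp: exp_of_nat_mult[symmetric] mult_exp_exp)
      also have "\<dots> \<le> exp (real n * (a * t\<^sup>2) - t * y)"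
        using J(2) a by (auto intro!: mult_right_mono)
      finally show "exp (- (t * y)) * exp (a * u\<^sup>2) ^ card J \<le> exp (a * real n * t\<^sup>2 - t * y)"
        by (simp add: mult_ac)
    qed
    finally show ?thesis .
  qed
  have "emeasure ?P {x \<in> space ?P. \<bar>\<Sum>j\<in>J. f (x j)\<bar> > y}
    \<le> emeasure ?P ({x \<in> space ?P. t * (\<Sum>j\<in>J. f (x j)) > t * y} \<union> {x \<in> space ?P. (- t) * (\<Sum>j\<in>J. f (x j)) > t * y})"
  proof (rule emeasure_mono)
    show "{x \<in> space ?P. \<bar>\<Sum>j\<in>J. f (x j)\<bar> > y} \<subseteq> {x \<in> space ?P. t * (\<Sum>j\<in>J. f (x j)) > t * y} \<union> {x \<in> space ?P. (- t) * (\<Sum>j\<in>J. f (x j)) > t * y}"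
    proof
      fix x assume x: "x \<in> {x \<in> space ?P. \<bar>\<Sum>j\<in>J. f (x j)\<bar> > y}"
      then have "y < (\<Sum>j\<in>J. f (x j)) \<or> y < - (\<Sum>j\<in>J. f (x j))" by auto
      then have "t * y < t * (\<Sum>j\<in>J. f (x j)) \<or> t * y < t * (- (\<Sum>j\<in>J. f (x j)))"
        using t mult_strict_left_mono by blast
      then show "x \<in> {x \<in> space ?P. t * (\<Sum>j\<in>J. f (x j)) > t * y} \<union> {x \<in> space ?P. (- t) * (\<Sum>j\<in>J. f (x j)) > t * y}"
        using x by auto
    qed
  qed measurable
  also have "\<dots> \<le> emeasure ?P {x \<in> space ?P. t * (\<Sum>j\<in>J. f (x j)) > t * y} + emeasure ?P {x \<in> space ?P. (- t) * (\<Sum>j\<in>J. f (x j)) > t * y}"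
    by (rule emeasure_subadditive) measurable
  also have "\<dots> \<le> ennreal (exp (a * real n * t\<^sup>2 - t * y)) + ennreal (exp (a * real n * t\<^sup>2 - t * y))"
    by (intro add_mono one) auto
  also have "\<dots> = ennreal (2 * exp (a * real n * t\<^sup>2 - t * y))"
    by (simp flip: ennreal_plus)
  finally show ?thesis .
qed

text \<open>The summands \<open>f (x i) (x j)\<close> are independent given \<open>x i\<close>.\<close>
lemma (in prob_space) PiM_chernoff_fixed:
  assumes f[measurable]: "(\<lambda>(x, y). f x y) \<in> borel_measurable (M \<Otimes>\<^sub>M M)" and i: "i < n"
    and mgf: "\<And>x u. x \<in> space M \<Longrightarrow> u = t \<or> u = - t \<Longrightarrow>
       (\<integral>\<^sup>+z. ennreal (exp (u * f x z)) \<partial>M) \<le> ennreal (exp (a * u\<^sup>2))"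
    and a: "0 \<le> a" and t: "0 < t"
  shows "emeasure (PiM {..<n} (\<lambda>_. M))
      {x \<in> space (PiM {..<n} (\<lambda>_. M)). \<bar>\<Sum>j\<in>{..<n} - {i}. f (x i) (x j)\<bar> > y}
    \<le> ennreal (2 * exp (a * real n * t\<^sup>2 - t * y))"
proof -
  define J where "J = {..<n} - {i}"
  have J: "finite J" "i \<notin> J" "insert i J = {..<n}" "card J \<le> n" using i by (auto simp: J_def)
  interpret P: product_prob_space "\<lambda>_. M" J by unfold_locales
  let ?P = "PiM {..<n} (\<lambda>_. M)"
  let ?E = "{x \<in> space ?P. \<bar>\<Sum>j\<in>J. f (x i) (x j)\<bar> > y}"
  have mP[measurable]: "(\<lambda>x. f (x i) (x j)) \<in> borel_measurable ?P" if "j \<in> J" for j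
    using that i unfolding J_def
    by (intro measurable_compose[OF _ f, of "\<lambda>x. (x i, x j)", simplified] measurable_Pair measurable_component_singleton) auto
  have E: "?E \<in> sets ?P" by measurable
  have "emeasure ?P ?E = (\<integral>\<^sup>+x. indicator ?E x \<partial>PiM (insert i J) (\<lambda>_. M))"
    using E J(3) by simp
  \<comment> \<open>Fubini with coordinate \<open>i\<close> outermost: for each fixed value
    \<open>z\<close> the inner integral is an instance of \<open>PiM_chernoff\<close> for the
    function \<open>f z\<close>.\<close>
  also have "\<dots> = (\<integral>\<^sup>+z. \<integral>\<^sup>+x. indicator ?E (x(i := z)) \<partial>PiM J (\<lambda>_. M) \<partial>M)"
    by (rule P.product_nn_integral_insert_rev) (use J E in auto)
  also have "\<dots> \<le> (\<integral>\<^sup>+z. ennreal (2 * exp (a * real n * t\<^sup>2 - t * y)) \<partial>M)"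
  proof (rule nn_integral_mono)
    fix z assume z: "z \<in> space M"
    have [measurable]: "f z \<in> borel_measurable M" using measurable_Pair2[OF f z] by simp
    have "(\<integral>\<^sup>+x. indicator ?E (x(i := z)) \<partial>PiM J (\<lambda>_. M))
        = (\<integral>\<^sup>+x. indicator {x \<in> space (PiM J (\<lambda>_. M)). \<bar>\<Sum>j\<in>J. f z (x j)\<bar> > y} x \<partial>PiM J (\<lambda>_. M))"
    proof (rule nn_integral_cong)
      fix x assume x: "x \<in> space (PiM J (\<lambda>_. M))"
      have "x(i := z) \<in> space ?P" using x z J(3) unfolding J(3)[symmetric] by (auto simp: space_PiM PiE_def extensional_def)
      moreover have "(\<Sum>j\<in>J. f z ((x(i := z)) j)) = (\<Sum>j\<in>J. f z (x j))"
        using J(2) by (intro sum.cong) auto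
      ultimately show "indicator ?E (x(i := z)) = (indicator {x \<in> space (PiM J (\<lambda>_. M)). \<bar>\<Sum>j\<in>J. f z (x j)\<bar> > y} x :: ennreal)"
        using x by (auto simp: indicator_def)
    qed
    also have "\<dots> = emeasure (PiM J (\<lambda>_. M)) {x \<in> space (PiM J (\<lambda>_. M)). \<bar>\<Sum>j\<in>J. f z (x j)\<bar> > y}"
      by (rule nn_integral_indicator) measurable
    also have "\<dots> \<le> ennreal (2 * exp (a * real n * t\<^sup>2 - t * y))"
      by (rule PiM_chernoff) (use J mgf z a t in auto)
    finally show "(\<integral>\<^sup>+x. indicator ?E (x(i := z)) \<partial>PiM J (\<lambda>_. M)) \<le> \<dots>" .
  qed
  also have "\<dots> = ennreal (2 * exp (a * real n * t\<^sup>2 - t * y))"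
    by (simp add: emeasure_space_1)
  finally show ?thesis unfolding J_def .
qed

section \<open>Exponential moments of centered distances given an event\<close>

locale gini_event = prob_space N for N :: "'b measure" +
  fixes A :: "'b set" and d :: "'b \<Rightarrow> 'b \<Rightarrow> real" and v :: "'b \<Rightarrow> real" and s b :: real
  assumes A_event[measurable]: "A \<in> events" and A_pos: "0 < prob A"
    and d_meas[measurable]: "(\<lambda>(x, y). d x y) \<in> borel_measurable (N \<Otimes>\<^sub>M N)"
    and v_meas[measurable]: "v \<in> borel_measurable N"
    and d_nonneg: "0 \<le> d x y" and d_sym: "d x y = d y x"
    and d_triangle: "d x z \<le> d x y + d y z" and d_le: "d x y \<le> v x + v y"
    and s_pos: "0 < s"
    and v_mgf: "(\<integral>\<^sup>+x. ennreal (exp (s * v x)) \<partial>uniform_measure N A) \<le> ennreal b"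
begin

text \<open>In the application \<open>d\<close> is the Euclidean distance and \<open>v\<close> the
  norm in one group of coordinates. Then \<open>g\<close> is the first-order projection of the
  kernel \<open>d\<close> under the conditional law \<open>Q\<close>, and \<open>\<Delta>\<close> is
  the Gini mean difference given \<open>A\<close>.\<close>

definition Q where "Q = uniform_measure N A"
definition g where "g x = (\<integral>y. d x y \<partial>Q)"
definition \<Delta> where "\<Delta> = (\<integral>x. g x \<partial>Q)"

lemma sets_Q[simp, measurable_cong]: "sets Q = events" and space_Q[simp]: "space Q = space N"
  by (simp_all add: Q_def)

lemma prob_space_Q: "prob_space Q"
  unfolding Q_def using A_pos by (intro prob_space_uniform_measure) (auto simp: emeasure_eq_measure)

sublocale Q: prob_space Q by (rule prob_space_Q)

lemma prob_Q[simp]: "Q.prob (space N) = 1"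
  using Q.prob_space by simp

lemma v_nonneg: "0 \<le> v x"
  using d_le[of x x] d_nonneg[of x x] by simp

text \<open>For negative \<open>b\<close> the right-hand side of \<open>v_mgf\<close> is truncated
  to 0, but a positive function has a positive integral over a probability space.\<close>

lemma b_nonneg: "0 \<le> b"
proof (rule ccontr)
  assume "\<not> 0 \<le> b"
  then have "(\<integral>\<^sup>+x. ennreal (exp (s * v x)) \<partial>Q) = 0"
    using v_mgf by (simp add: Q_def ennreal_neg)
  then have "AE x in Q. ennreal (exp (s * v x)) = 0"
    by (subst (asm) nn_integral_0_iff_AE) auto
  then have "AE x in Q. False" by eventually_elim simp
  then show False by (simp add: Q.AE_const)
qed

lemma integrable_exp_v: "integrable Q (\<lambda>x. exp (s * v x))"
  by (rule integrableI_bounded) (use v_mgf in \<open>auto simp: less_top[symmetric] top_unique Q_def\<close>)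

lemma expectation_exp_v: "(\<integral>x. exp (s * v x) \<partial>Q) \<le> b"
  using v_mgf b_nonneg nn_integral_eq_integral[OF integrable_exp_v]
  by (simp add: integral_nonneg_AE Q_def)

lemma v_le_exp: "v x \<le> exp (s * v x) / s"
  using order_trans[OF _ exp_ge_add_one_self, of "s * v x" "s * v x"] s_pos by (simp add: field_simps)

lemma integrable_v: "integrable Q v"
  by (rule Bochner_Integration.integrable_bound[of Q "\<lambda>x. exp (s * v x) / s"])
     (use v_le_exp v_nonneg s_pos integrable_exp_v in auto)

definition \<mu> where "\<mu> = (\<integral>x. v x \<partial>Q)"

lemma \<mu>_le: "\<mu> \<le> b / s"
proof -
  have "\<mu> \<le> (\<integral>x. exp (s * v x) / s \<partial>Q)"
    unfolding \<mu>_def by (intro integral_mono integrable_v v_le_exp) (use integrable_exp_v in auto)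
  then show ?thesis using expectation_exp_v s_pos by (simp add: divide_right_mono order_trans)
qed

lemma d_meas1[measurable]: "x \<in> space N \<Longrightarrow> d x \<in> borel_measurable N"
  using measurable_Pair2[OF d_meas] by simp

lemma integrable_d: "x \<in> space N \<Longrightarrow> integrable Q (d x)"
  by (rule Bochner_Integration.integrable_bound[of Q "\<lambda>y. v x + v y"])
     (use d_le d_nonneg v_nonneg integrable_v in auto)

lemma g_meas[measurable]: "g \<in> borel_measurable N"
proof -
  have [measurable]: "(\<lambda>(x, y). d x y) \<in> borel_measurable (N \<Otimes>\<^sub>M Q)"
    by (subst measurable_cong_sets[OF sets_pair_measure_cong[OF refl sets_Q] refl]) measurable
  show ?thesis unfolding g_def by measurable
qed

lemma abs_d_diff_le: "\<bar>d x z - d y z\<bar> \<le> d x y"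
  using d_triangle[of x z y] d_triangle[of y z x] d_sym[of x y] by linarith

text \<open>By the triangle inequality
  \<open>\<bar>d x y - d x z\<bar> \<le> d y z \<le> v y + v z\<close>; averaging over
  \<open>z\<close> gives a bound free of \<open>x\<close>. This makes the Chernoff bound for the row
  of \<open>x\<close> uniform in \<open>x\<close>.\<close>

lemma abs_d_minus_g_le:
  assumes x: "x \<in> space N" and y: "y \<in> space N"
  shows "\<bar>d x y - g x\<bar> \<le> v y + \<mu>"
proof -
  have "d x y - g x = (\<integral>z. d x y - d x z \<partial>Q)"
    using integrable_d[OF x] by (simp add: g_def Q.prob_space)
  also have "\<bar>\<dots>\<bar> \<le> (\<integral>z. \<bar>d x y - d x z\<bar> \<partial>Q)" by (rule integral_abs_bound)
  also have "\<dots> \<le> (\<integral>z. v y + v z \<partial>Q)"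
  proof (rule integral_mono)
    show "\<bar>d x y - d x z\<bar> \<le> v y + v z" for z
      using abs_d_diff_le[of y x z] d_le[of y z] by (simp add: d_sym)
  qed (use integrable_d[OF x] integrable_v in auto)
  also have "\<dots> = v y + \<mu>" using integrable_v by (simp add: \<mu>_def Q.prob_space)
  finally show ?thesis .
qed

text \<open>Averaging the reverse triangle inequality over the third point: \<open>g\<close> is
  1-Lipschitz for \<open>d\<close>, so it inherits the bounds for \<open>d x\<close>.\<close>

lemma abs_g_diff_le:
  assumes "x \<in> space N" "y \<in> space N"
  shows "\<bar>g x - g y\<bar> \<le> d x y"
proof -
  have "g x - g y = (\<integral>z. d x z - d y z \<partial>Q)"
    using assms by (simp add: g_def integrable_d)
  also have "\<bar>\<dots>\<bar> \<le> (\<integral>z. \<bar>d x z - d y z\<bar> \<partial>Q)" by (rule integral_abs_bound)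
  also have "\<dots> \<le> (\<integral>z. d x y \<partial>Q)"
    using assms by (intro integral_mono abs_d_diff_le) (auto simp: integrable_d)
  finally show ?thesis by (simp add: Q.prob_space)
qed

lemma g_nonneg: "0 \<le> g x"
  unfolding g_def by (simp add: integral_nonneg_AE d_nonneg)

lemma g_le: "x \<in> space N \<Longrightarrow> g x \<le> v x + \<mu>"
proof -
  assume x: "x \<in> space N"
  have "g x \<le> (\<integral>z. v x + v z \<partial>Q)" unfolding g_def
    by (intro integral_mono d_le) (use integrable_d[OF x] integrable_v in auto)
  then show ?thesis using integrable_v by (simp add: \<mu>_def Q.prob_space)
qed

lemma integrable_g: "integrable Q g"
  by (rule Bochner_Integration.integrable_bound[of Q "\<lambda>y. v y + \<mu>"])
     (use g_le g_nonneg v_nonneg integrable_v in \<open>auto intro!: AE_I2 simp: order_trans[OF g_nonneg g_le]\<close>)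

lemma \<Delta>_nonneg: "0 \<le> \<Delta>"
  unfolding \<Delta>_def by (simp add: integral_nonneg_AE g_nonneg)

lemma \<Delta>_le: "\<Delta> \<le> 2 * b / s"
proof -
  have "\<Delta> \<le> (\<integral>y. v y + \<mu> \<partial>Q)"
    unfolding \<Delta>_def by (intro integral_mono g_le integrable_g) (use integrable_v in auto)
  also have "\<dots> = 2 * \<mu>" using integrable_v by (simp add: \<mu>_def Q.prob_space)
  finally show ?thesis using \<mu>_le by simp
qed

lemma abs_g_minus_\<Delta>_le:
  assumes y: "y \<in> space N"
  shows "\<bar>g y - \<Delta>\<bar> \<le> v y + \<mu>"
proof -
  have "g y - \<Delta> = (\<integral>z. g y - g z \<partial>Q)"
    using integrable_g by (simp add: \<Delta>_def Q.prob_space)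
  also have "\<bar>\<dots>\<bar> \<le> (\<integral>z. \<bar>g y - g z\<bar> \<partial>Q)" by (rule integral_abs_bound)
  also have "\<dots> \<le> (\<integral>z. v y + v z \<partial>Q)"
  proof (rule integral_mono)
    show "\<bar>g y - g z\<bar> \<le> v y + v z" if "z \<in> space Q" for z
      using abs_g_diff_le[of y z] d_le[of y z] y that by simp
  qed (use integrable_g integrable_v in auto)
  also have "\<dots> = v y + \<mu>" using integrable_v by (simp add: \<mu>_def Q.prob_space)
  finally show ?thesis .
qed

text \<open>The first summand is the constant of \<open>nn_integral_exp_le_quadratic\<close> for the
  weight \<open>v x + \<mu>\<close>, whose exponential moment is at most \<open>b * exp b\<close>.
  The summand 3 bounds \<open>exp 1\<close> and serves the class counts in
  \<open>indicator_mgf\<close>.\<close>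

definition var_const where "var_const = 8 * (b * exp b) / s\<^sup>2 + 3"

lemma var_const_ge: "3 \<le> var_const"
  using b_nonneg by (simp add: var_const_def)

lemma mgf_w: "(\<integral>\<^sup>+x. ennreal (exp (s * (v x + \<mu>))) \<partial>Q) \<le> ennreal (b * exp b)"
proof -
  have "(\<integral>\<^sup>+x. ennreal (exp (s * (v x + \<mu>))) \<partial>Q)
      = (\<integral>\<^sup>+x. ennreal (exp (s * v x)) * ennreal (exp (s * \<mu>)) \<partial>Q)"
    by (intro nn_integral_cong) (simp add: distrib_left exp_add ennreal_mult)
  also have "\<dots> = (\<integral>\<^sup>+x. ennreal (exp (s * v x)) \<partial>Q) * ennreal (exp (s * \<mu>))"
    by (rule nn_integral_multc) measurable
  also have "\<dots> \<le> ennreal b * ennreal (exp b)"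
    using \<mu>_le s_pos v_mgf by (intro mult_mono ennreal_leI) (auto simp: Q_def field_simps)
  finally show ?thesis using b_nonneg by (simp add: ennreal_mult)
qed

text \<open>The quadratic bound is applied under the conditional law and then moved to
  \<open>N\<close>, where it gains the factor \<open>prob A\<close>. The Chernoff rate is therefore
  of the order of the expected number of observations in \<open>A\<close>.\<close>

lemma centered_mgf:
  assumes [measurable]: "f \<in> borel_measurable N" and int: "integrable Q f" "(\<integral>x. f x \<partial>Q) = 0"
    and bound: "\<And>x. x \<in> space N \<Longrightarrow> \<bar>f x\<bar> \<le> v x + \<mu>" and u: "\<bar>u\<bar> \<le> s / 2"
  shows "(\<integral>\<^sup>+x. ennreal (exp (u * (indicator A x * f x))) \<partial>N) \<le> ennreal (exp (var_const * prob A * u\<^sup>2))"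
proof -
  have "(\<integral>\<^sup>+x. ennreal (exp (u * f x)) \<partial>Q) \<le> ennreal (1 + 8 * (b * exp b) / s\<^sup>2 * u\<^sup>2)"
    by (rule Q.nn_integral_exp_le_quadratic[where w="\<lambda>x. v x + \<mu>"])
       (use int bound u mgf_w s_pos b_nonneg in auto)
  also have "\<dots> \<le> ennreal (1 + var_const * u\<^sup>2)"
    by (intro ennreal_leI add_left_mono mult_right_mono) (auto simp: var_const_def)
  finally have "(\<integral>\<^sup>+x. ennreal (exp (indicator A x * (u * f x))) \<partial>N) \<le> ennreal (exp (var_const * u\<^sup>2 * prob A))"
    using A_pos var_const_ge
    by (intro nn_integral_uniform_measure_exp)
       (auto simp: Q_def intro: order_trans[of "-1" 0])
  then show ?thesis by (simp add: mult_ac)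
qed

text \<open>The bound \<open>exp ((exp u - 1) * prob A)\<close> holds before centering; centering
  cancels the linear part, and \<open>exp u - 1 - u \<le> 3 * u\<^sup>2\<close> for
  \<open>\<bar>u\<bar> \<le> 1\<close>.\<close>

lemma indicator_mgf:
  assumes u: "\<bar>u\<bar> \<le> 1"
  shows "(\<integral>\<^sup>+x. ennreal (exp (u * (indicator A x - prob A))) \<partial>N) \<le> ennreal (exp (var_const * prob A * u\<^sup>2))"
proof -
  have eu: "exp u - 1 - u \<le> var_const * u\<^sup>2"
  proof -
    have "u\<^sup>2 * exp \<bar>u\<bar> \<le> u\<^sup>2 * 3"
      using u exp_le by (intro mult_left_mono) (auto intro: order_trans[of _ "exp 1"])
    also have "\<dots> \<le> var_const * u\<^sup>2" using var_const_ge mult_right_mono[of 3 var_const "u\<^sup>2"] by simp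
    finally show ?thesis using exp_le_quadratic[of u] by linarith
  qed
  have "(\<integral>\<^sup>+x. ennreal (exp (indicator A x * u)) \<partial>N) \<le> ennreal (exp ((exp u - 1) * prob A))"
    using A_pos by (intro nn_integral_uniform_measure_exp) (auto simp: Q.emeasure_space_1[unfolded Q_def, simplified])
  then have "(\<integral>\<^sup>+x. ennreal (exp (indicator A x * u)) \<partial>N) * ennreal (exp (- (u * prob A)))
      \<le> ennreal (exp ((exp u - 1) * prob A)) * ennreal (exp (- (u * prob A)))"
    by (rule mult_right_mono) simp
  also have "\<dots> = ennreal (exp ((exp u - 1 - u) * prob A))"
    by (simp add: ennreal_mult[symmetric] mult_exp_exp algebra_simps)
  also have "\<dots> \<le> ennreal (exp (var_const * prob A * u\<^sup>2))"
    using mult_right_mono[OF eu, of "prob A"] by (intro ennreal_leI) (simp add: mult_ac)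
  finally show ?thesis
    by (subst (asm) nn_integral_multc[symmetric])
       (auto simp: ennreal_mult[symmetric] mult_exp_exp algebra_simps)
qed

end

subsection \<open>Concentration of the sample mean difference\<close>

text \<open>Passing to ordered pairs gives every \<open>i\<close> a complete row of distances, to
  which the bound for fixed \<open>x i\<close> applies.\<close>

lemma sum_ordered_pairs_symmetric:
  fixes f :: "nat \<Rightarrow> nat \<Rightarrow> real"
  assumes "finite S" and sym: "\<And>i j. f i j = f j i"
  shows "(\<Sum>i\<in>S. \<Sum>j\<in>S - {i}. f i j) = 2 * (\<Sum>i\<in>S. \<Sum>j | j \<in> S \<and> i < j. f i j)"
proof -
  have "(\<Sum>i\<in>S. \<Sum>j\<in>S - {i}. f i j) = (\<Sum>i\<in>S. (\<Sum>j | j \<in> S \<and> i < j. f i j) + (\<Sum>j | j \<in> S \<and> j < i. f i j))"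
  proof (rule sum.cong[OF refl])
    fix i
    have "S - {i} = {j. j \<in> S \<and> i < j} \<union> {j. j \<in> S \<and> j < i}" by auto
    then show "(\<Sum>j\<in>S - {i}. f i j) = (\<Sum>j | j \<in> S \<and> i < j. f i j) + (\<Sum>j | j \<in> S \<and> j < i. f i j)"
      using assms(1) by (simp add: sum.union_disjoint disjoint_iff)
  qed
  also have "(\<Sum>i\<in>S. \<Sum>j | j \<in> S \<and> j < i. f i j) = (\<Sum>i\<in>S. \<Sum>j | j \<in> S \<and> i < j. f j i)"
    using sum.swap_restrict[OF assms(1) assms(1), of "\<lambda>i j. f i j" "\<lambda>i j. j < i"] by simp
  ultimately show ?thesis by (simp add: sum.distrib sym)
qed

text \<open>
  The minimum is the argument \<open>t\<close> of the moment generating function: small enough that the quadratic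
  term of the Chernoff exponent is at most half of the linear one.
\<close>
definition deviation_rate :: "real \<Rightarrow> real \<Rightarrow> real \<Rightarrow> real" where
  "deviation_rate s b \<epsilon> =
     \<epsilon> / 2 * min (min (s / 2) 1) (\<epsilon> / (2 * (8 * (b * exp b) / s\<^sup>2 + 3)))"

lemma deviation_rate_pos: "0 < s \<Longrightarrow> 0 \<le> b \<Longrightarrow> 0 < \<epsilon> \<Longrightarrow> 0 < deviation_rate s b \<epsilon>"
  unfolding deviation_rate_def by (auto intro!: mult_pos_pos divide_pos_pos add_nonneg_pos)

context gini_event
begin

abbreviation "sample n \<equiv> PiM {..<n} (\<lambda>_. N)"

text \<open>These are the row sums, the sum of projections and the class count that together control
  the U-statistic on \<open>A\<close>. The tolerance is relative to the expected count
  \<open>n * prob A\<close>; the diagonal is left out of the rows because \<open>x i\<close> is not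
  independent of itself.\<close>

definition typical :: "nat \<Rightarrow> real \<Rightarrow> (nat \<Rightarrow> 'b) \<Rightarrow> bool" where
  "typical n \<epsilon> x \<longleftrightarrow>
     (\<forall>i<n. \<bar>\<Sum>j\<in>{..<n} - {i}. indicator A (x j) * (d (x i) (x j) - g (x i))\<bar> \<le> \<epsilon> * n * prob A) \<and>
     \<bar>\<Sum>j<n. indicator A (x j) * (g (x j) - \<Delta>)\<bar> \<le> \<epsilon> * n * prob A \<and>
     \<bar>\<Sum>j<n. indicator A (x j) - prob A\<bar> \<le> \<epsilon> * n * prob A"

text \<open>Union bound over \<open>n\<close> row sums and two single sums, each failing with
  probability at most twice the exponential, hence \<open>2 * (n + 2)\<close>.\<close>

lemma exceptional_set:
  assumes eps: "0 < \<epsilon>"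
  obtains E where "E \<in> sets (sample n)" "\<And>x. x \<in> space (sample n) - E \<Longrightarrow> typical n \<epsilon> x"
    "emeasure (sample n) E \<le> ennreal (real (2 * n + 4) * exp (- deviation_rate s b \<epsilon> * n * prob A))"
proof -
  define t where "t = min (min (s / 2) 1) (\<epsilon> / (2 * var_const))"
  have t: "0 < t" "t \<le> s / 2" "t \<le> 1" "t \<le> \<epsilon> / (2 * var_const)"
    using s_pos eps var_const_ge by (auto simp: t_def intro!: divide_pos_pos)
  then have vt: "var_const * t \<le> \<epsilon> / 2"
    using var_const_ge by (simp add: field_simps)
  have rate: "deviation_rate s b \<epsilon> = \<epsilon> / 2 * t"
    by (simp add: deviation_rate_def t_def var_const_def)
  have expo: "2 * exp (var_const * prob A * real n * t\<^sup>2 - t * (\<epsilon> * n * prob A))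
      \<le> 2 * exp (- deviation_rate s b \<epsilon> * n * prob A)"
  proof -
    have "(var_const * t) * (t * n * prob A) \<le> (\<epsilon> / 2) * (t * n * prob A)"
      using t vt by (intro mult_right_mono) auto
    then show ?thesis by (simp add: rate power2_eq_square algebra_simps)
  qed
  define T where "T i = {x \<in> space (sample n).
      \<bar>\<Sum>j\<in>{..<n} - {i}. indicator A (x j) * (d (x i) (x j) - g (x i))\<bar> > \<epsilon> * n * prob A}" for i
  define F where "F f = {x \<in> space (sample n). \<bar>\<Sum>j<n. f (x j)\<bar> > \<epsilon> * n * prob A}" for f :: "'b \<Rightarrow> real"
  let ?f = "\<lambda>x. indicator A x * (g x - \<Delta>)" and ?c = "\<lambda>x. indicator A x - prob A"
  let ?p = "ennreal (2 * exp (- deviation_rate s b \<epsilon> * n * prob A))"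
  have m2[measurable]: "(\<lambda>(x, y). indicator A y * (d x y - g x)) \<in> borel_measurable (N \<Otimes>\<^sub>M N)"
    by measurable
  have T_meas: "T i \<in> sets (sample n)" if "i < n" for i
  proof -
    have [measurable]: "(\<lambda>x. indicator A (x j) * (d (x i) (x j) - g (x i))) \<in> borel_measurable (sample n)"
      if "j \<in> {..<n} - {i}" for j
      using that \<open>i < n\<close>
      by (intro measurable_compose[OF _ m2, of "\<lambda>x. (x i, x j)", simplified] measurable_Pair measurable_component_singleton) auto
    show ?thesis unfolding T_def by measurable
  qed
  have F_meas: "F f \<in> sets (sample n)" if [measurable]: "f \<in> borel_measurable N" for f
    unfolding F_def by measurable
  have T_le: "emeasure (sample n) (T i) \<le> ?p" if "i < n" for i
    unfolding T_def
  proof (rule order_trans[OF PiM_chernoff_fixed[OF m2 that] ennreal_leI[OF expo]])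
    fix x u assume x: "x \<in> space N" and u: "u = t \<or> u = - t"
    show "(\<integral>\<^sup>+z. ennreal (exp (u * (indicator A z * (d x z - g x)))) \<partial>N) \<le> ennreal (exp (var_const * prob A * u\<^sup>2))"
      using x t u by (intro centered_mgf) (auto simp: integrable_d abs_d_minus_g_le[unfolded g_def] g_def)
  qed (use t var_const_ge in auto)
  have f_le: "emeasure (sample n) (F ?f) \<le> ?p"
    unfolding F_def
  proof (rule order_trans[OF PiM_chernoff ennreal_leI[OF expo]])
    fix u assume u: "u = t \<or> u = - t"
    show "(\<integral>\<^sup>+z. ennreal (exp (u * (indicator A z * (g z - \<Delta>)))) \<partial>N) \<le> ennreal (exp (var_const * prob A * u\<^sup>2))"
      using t u by (intro centered_mgf) (auto simp: integrable_g abs_g_minus_\<Delta>_le[unfolded \<Delta>_def] \<Delta>_def)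
  qed (use t var_const_ge in auto)
  have c_le: "emeasure (sample n) (F ?c) \<le> ?p"
    unfolding F_def
  proof (rule order_trans[OF PiM_chernoff ennreal_leI[OF expo]])
    fix u assume u: "u = t \<or> u = - t"
    show "(\<integral>\<^sup>+z. ennreal (exp (u * (indicator A z - prob A))) \<partial>N) \<le> ennreal (exp (var_const * prob A * u\<^sup>2))"
      using t u by (intro indicator_mgf) auto
  qed (use t var_const_ge in auto)
  define E where "E = (\<Union>i<n. T i) \<union> (F ?f \<union> F ?c)"
  show ?thesis
  proof (rule that[of E])
    show "E \<in> sets (sample n)"
      unfolding E_def using T_meas F_meas[of ?f] F_meas[of ?c] by auto
    show "typical n \<epsilon> x" if "x \<in> space (sample n) - E" for x
      using that by (auto simp: E_def T_def F_def typical_def not_less)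
    have "emeasure (sample n) E \<le> emeasure (sample n) (\<Union>i<n. T i) + (emeasure (sample n) (F ?f) + emeasure (sample n) (F ?c))"
      unfolding E_def using T_meas F_meas[of ?f] F_meas[of ?c]
      by (intro order_trans[OF emeasure_subadditive] add_left_mono emeasure_subadditive) auto
    also have "\<dots> \<le> (\<Sum>i<n. ?p) + (?p + ?p)"
      using T_meas T_le f_le c_le
      by (intro add_mono order_trans[OF emeasure_subadditive_finite] sum_mono) auto
    also have "\<dots> = of_nat (n + 2) * ?p" by (simp add: distrib_right)
    also have "\<dots> = ennreal (real (2 * n + 4) * exp (- deviation_rate s b \<epsilon> * n * prob A))"
      unfolding ennreal_of_nat_eq_real_of_nat by (subst ennreal_mult[symmetric]) (auto simp: algebra_simps)
    finally show "emeasure (sample n) E \<le> \<dots>" .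
  qed
qed

text \<open>With \<open>m\<close> observations in \<open>A\<close>, twice the sum of distances minus
  \<open>m * (m - 1) * \<Delta>\<close> equals the sum of the centered rows plus
  \<open>m - 1\<close> times the sum of the centered projections. Since \<open>m - 1\<close> is at
  least half of \<open>n * prob A\<close>, each part is at most
  \<open>2 * \<epsilon> * (m * (m - 1))\<close>.\<close>

lemma typical_estimates:
  assumes tp: "typical n \<epsilon> x" and eps: "0 < \<epsilon>" "\<epsilon> \<le> 1 / 4" and large: "4 \<le> n * prob A"
  defines "S \<equiv> {i. i < n \<and> x i \<in> A}"
  shows "\<bar>real (card S) / n - prob A\<bar> \<le> \<epsilon> * prob A"
    and "\<bar>(\<Sum>i\<in>S. \<Sum>j | j \<in> S \<and> i < j. d (x i) (x j)) / real (card S choose 2) - \<Delta>\<bar> \<le> 4 * \<epsilon>"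
proof -
  define m where "m = real (card S)"
  define a where "a = n * prob A"
  have S: "finite S" "S \<subseteq> {..<n}" by (auto simp: S_def)
  have n: "0 < n" using large by (cases n) auto
  have ind: "(\<Sum>j\<in>J. indicator A (x j) * f j) = (\<Sum>j\<in>J \<inter> S. f j)" if "finite J" "J \<subseteq> {..<n}" for J and f :: "nat \<Rightarrow> real"
    unfolding sum.inter_restrict[OF that(1)] using that(2) by (auto simp: indicator_def S_def intro!: sum.cong)
  have "(\<Sum>j<n. indicator A (x j) - prob A) = m - a"
    using ind[of "{..<n}" "\<lambda>_. 1"] S by (simp add: sum_subtractf m_def a_def Int_absorb1)
  then have m: "\<bar>m - a\<bar> \<le> \<epsilon> * a" using tp by (simp add: typical_def a_def mult.assoc)
  then have "\<bar>(m - a) / n\<bar> \<le> \<epsilon> * a / n"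
    by (simp add: divide_right_mono)
  then show "\<bar>real (card S) / n - prob A\<bar> \<le> \<epsilon> * prob A"
    using n by (simp add: m_def a_def diff_divide_distrib)
  \<comment> \<open>This leaves \<open>m \<ge> 3 / 4 * a\<close>, and \<open>a \<ge> 4\<close> pays
    for the subtracted 1. In particular \<open>m \<ge> 3\<close>, so the binomial coefficient is not
    0.\<close>
  have "\<epsilon> * a \<le> 1 / 4 * a" using eps large by (intro mult_right_mono) (auto simp: a_def)
  then have m1: "a / 2 \<le> m - 1" "a / 2 \<le> m" using m large by (auto simp: a_def abs_le_iff)
  have a4: "4 \<le> a" using large by (simp add: a_def)
  define T where "T i = (\<Sum>j\<in>S - {i}. d (x i) (x j) - g (x i))" for i
  have T: "\<bar>T i\<bar> \<le> \<epsilon> * a" if "i \<in> S" for i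
  proof -
    have "T i = (\<Sum>j\<in>{..<n} - {i}. indicator A (x j) * (d (x i) (x j) - g (x i)))"
      unfolding T_def by (subst ind) (use S in \<open>auto intro!: sum.cong\<close>)
    then show ?thesis using tp that S by (auto simp: typical_def a_def mult.assoc)
  qed
  have G: "\<bar>\<Sum>i\<in>S. g (x i) - \<Delta>\<bar> \<le> \<epsilon> * a"
    using tp ind[of "{..<n}" "\<lambda>i. g (x i) - \<Delta>"] S by (simp add: typical_def a_def Int_absorb1 mult.assoc)
  define W where "W = (\<Sum>i\<in>S. \<Sum>j | j \<in> S \<and> i < j. d (x i) (x j))"
  have cS: "real (card (S - {i})) = m - 1" if "i \<in> S" for i
    using that S m1 a4 by (simp add: m_def of_nat_diff)
  have "2 * W = (\<Sum>i\<in>S. \<Sum>j\<in>S - {i}. d (x i) (x j))"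
    unfolding W_def by (rule sum_ordered_pairs_symmetric[symmetric, OF S(1) d_sym])
  \<comment> \<open>Each distance is split as
    \<open>(d (x i) (x j) - g (x i)) + (g (x i) - \<Delta>) + \<Delta>\<close>, and a row has
    \<open>m - 1\<close> entries.\<close>
  also have "\<dots> = (\<Sum>i\<in>S. T i + (m - 1) * (g (x i) - \<Delta>) + (m - 1) * \<Delta>)"
  proof (rule sum.cong[OF refl])
    fix i assume i: "i \<in> S"
    have "T i = (\<Sum>j\<in>S - {i}. d (x i) (x j)) - (m - 1) * g (x i)"
      by (simp only: T_def sum_subtractf sum_constant cS[OF i])
    then show "(\<Sum>j\<in>S - {i}. d (x i) (x j)) = T i + (m - 1) * (g (x i) - \<Delta>) + (m - 1) * \<Delta>"
      by (simp add: algebra_simps)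
  qed
  also have "\<dots> = (\<Sum>i\<in>S. T i) + (m - 1) * (\<Sum>i\<in>S. g (x i) - \<Delta>) + m * (m - 1) * \<Delta>"
    by (simp add: sum.distrib sum_distrib_left m_def)
  finally have W: "2 * W - m * (m - 1) * \<Delta> = (\<Sum>i\<in>S. T i) + (m - 1) * (\<Sum>i\<in>S. g (x i) - \<Delta>)" by simp
  have "\<bar>\<Sum>i\<in>S. T i\<bar> \<le> (\<Sum>i\<in>S. \<epsilon> * a)"
    by (rule order_trans[OF sum_abs sum_mono[OF T]])
  also have "\<dots> = m * (\<epsilon> * a)" by (simp add: m_def)
  also have "\<dots> \<le> m * (\<epsilon> * (2 * (m - 1)))" using m1 a4 eps by (intro mult_left_mono) auto
  finally have 1: "\<bar>\<Sum>i\<in>S. T i\<bar> \<le> 2 * \<epsilon> * (m * (m - 1))" by (simp add: mult_ac)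
  have "\<bar>(m - 1) * (\<Sum>i\<in>S. g (x i) - \<Delta>)\<bar> \<le> (m - 1) * (\<epsilon> * a)"
    using G m1 a4 by (simp add: abs_mult mult_left_mono)
  also have "\<dots> \<le> (m - 1) * (\<epsilon> * (2 * m))" using m1 a4 eps by (intro mult_left_mono) auto
  finally have 2: "\<bar>(m - 1) * (\<Sum>i\<in>S. g (x i) - \<Delta>)\<bar> \<le> 2 * \<epsilon> * (m * (m - 1))" by (simp add: mult_ac)
  have mm: "0 < m * (m - 1)" using m1 a4 by auto
  have C: "real (card S choose 2) = m * (m - 1) / 2"
    using m1 a4 by (simp add: choose_two real_of_nat_div m_def of_nat_diff)
  have "W / real (card S choose 2) - \<Delta> = (2 * W - m * (m - 1) * \<Delta>) / (m * (m - 1))"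
    unfolding C using m1 a4 by (auto simp: diff_divide_distrib)
  also have "\<bar>\<dots>\<bar> \<le> 4 * \<epsilon>"
    using 1 2 mm W by (simp add: divide_le_eq abs_le_iff)
  finally show "\<bar>(\<Sum>i\<in>S. \<Sum>j | j \<in> S \<and> i < j. d (x i) (x j)) / real (card S choose 2) - \<Delta>\<bar> \<le> 4 * \<epsilon>"
    by (simp add: W_def)
qed

end

subsection \<open>Laws of groups of coordinates\<close>

locale grouped_law = prob_space D for D :: "((nat \<Rightarrow> real) \<times> 'c) measure" +
  fixes p :: nat and C :: "'c set"
  assumes sets_D[measurable_cong]: "sets D = sets (obs_space p C)" and finite_C: "finite C"
begin

lemma space_D: "space D = space (vec_space {..<p}) \<times> C"
  using sets_eq_imp_space_eq[OF sets_D] by (simp add: space_pair_measure)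

lemma class_event_eq: "k \<in> C \<Longrightarrow> class_event D k = space (vec_space {..<p}) \<times> {k}"
  by (auto simp: class_event_def space_D)

lemma class_event_sets[measurable]: "k \<in> C \<Longrightarrow> class_event D k \<in> events"
  unfolding class_event_eq by (subst sets_D) (auto intro!: pair_measureI)

lemma coord_meas[measurable]: "j < p \<Longrightarrow> (\<lambda>z. fst z j) \<in> borel_measurable D"
  by measurable

lemma restrict_meas[measurable]:
  "I \<subseteq> {..<p} \<Longrightarrow> (\<lambda>z. restrict (fst z) I) \<in> measurable D (vec_space I)"
  by (intro measurable_restrict) auto

lemma L2_set_meas[measurable]: "(\<lambda>x. L2_set x I) \<in> borel_measurable (vec_space I)"
  unfolding L2_set_def by measurable

lemma nn_integral_group_law:
  assumes I: "I \<subseteq> {..<p}" and [measurable_cong]: "sets Q = events"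
  shows "(\<integral>\<^sup>+x. ennreal (exp (s * L2_set x I)) \<partial>group_law Q I)
       = (\<integral>\<^sup>+z. ennreal (exp (s * L2_set (fst z) I)) \<partial>Q)"
  using I unfolding group_law_def
  by (subst nn_integral_distr) (auto simp: measurable_cong_sets[OF assms(2) refl] cong: L2_set_cong)

lemma gini_eventI:
  assumes I: "I \<subseteq> {..<p}" and A: "A \<in> events" "0 < prob A" and s: "0 < s"
    and mgf: "(\<integral>\<^sup>+x. ennreal (exp (s * L2_set x I)) \<partial>group_law (uniform_measure D A) I) \<le> ennreal b"
  shows "gini_event D A (\<lambda>x y. L2_set (\<lambda>j. fst x j - fst y j) I) (\<lambda>x. L2_set (fst x) I) s b"
proof
  have [measurable]: "(\<lambda>z. fst z j) \<in> borel_measurable D" if "j \<in> I" for j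
    using that I by (intro coord_meas) auto
  show "(\<lambda>(x, y). L2_set (\<lambda>j. fst x j - fst y j) I) \<in> borel_measurable (D \<Otimes>\<^sub>M D)"
    unfolding L2_set_def by measurable
  show "(\<lambda>x. L2_set (fst x) I) \<in> borel_measurable D"
    unfolding L2_set_def by measurable
  fix x y z :: "(nat \<Rightarrow> real) \<times> 'c"
  show "L2_set (\<lambda>j. fst x j - fst y j) I = L2_set (\<lambda>j. fst y j - fst x j) I"
    by (simp add: L2_set_def power2_commute)
  show "L2_set (\<lambda>j. fst x j - fst z j) I \<le> L2_set (\<lambda>j. fst x j - fst y j) I + L2_set (\<lambda>j. fst y j - fst z j) I"
    using L2_set_triangle_ineq[of "\<lambda>j. fst x j - fst y j" "\<lambda>j. fst y j - fst z j" I] by simp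
  show "L2_set (\<lambda>j. fst x j - fst y j) I \<le> L2_set (fst x) I + L2_set (fst y) I"
    using L2_set_triangle_ineq[of "fst x" "\<lambda>j. - fst y j" I] by (simp add: L2_set_def)
qed (use assms in \<open>auto simp: nn_integral_group_law\<close>)

text \<open>The left side integrates over a product of image measures, the right side is an iterated
  integral over observations. The product of images is the image of the product, and Fubini applies
  by \<open>integrable_d\<close> and \<open>integrable_g\<close>.\<close>

lemma gini_mean_diff_eq:
  assumes I: "I \<subseteq> {..<p}"
    and "gini_event D A (\<lambda>x y. L2_set (\<lambda>j. fst x j - fst y j) I) (\<lambda>x. L2_set (fst x) I) s b"
  shows "gini_mean_diff I (group_law (uniform_measure D A) I)
    = gini_event.\<Delta> D A (\<lambda>x y. L2_set (\<lambda>j. fst x j - fst y j) I)"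
proof -
  interpret E: gini_event D A "\<lambda>x y. L2_set (\<lambda>j. fst x j - fst y j) I" "\<lambda>x. L2_set (fst x) I" s b
    by (rule assms(2))
  interpret QQ: pair_prob_space E.Q E.Q ..
  let ?r = "\<lambda>z. restrict (fst z) I" and ?f = "\<lambda>z. L2_set (\<lambda>j. fst z j - snd z j) I"
  have r[measurable]: "?r \<in> measurable E.Q (vec_space I)"
    using restrict_meas[OF I] by (simp add: measurable_cong_sets[OF E.sets_Q refl])
  interpret R: prob_space "distr E.Q (vec_space I) ?r" by (rule E.Q.prob_space_distr[OF r])
  have f[measurable]: "?f \<in> borel_measurable (vec_space I \<Otimes>\<^sub>M vec_space I)"
    unfolding L2_set_def by measurable
  have d: "(\<lambda>(x, y). L2_set (\<lambda>j. fst x j - fst y j) I) \<in> borel_measurable (E.Q \<Otimes>\<^sub>M E.Q)"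
    by (subst measurable_cong_sets[OF sets_pair_measure_cong[OF E.sets_Q E.sets_Q] refl]) (rule E.d_meas)
  have int: "integrable (E.Q \<Otimes>\<^sub>M E.Q) (\<lambda>(x, y). L2_set (\<lambda>j. fst x j - fst y j) I)"
  proof (rule QQ.Fubini_integrable[OF d])
    show "integrable E.Q (\<lambda>x. \<integral>y. norm (case (x, y) of (x, y) \<Rightarrow> L2_set (\<lambda>j. fst x j - fst y j) I) \<partial>E.Q)"
      using E.integrable_g by (simp add: E.g_def[abs_def])
    show "AE x in E.Q. integrable E.Q (\<lambda>y. case (x, y) of (x, y) \<Rightarrow> L2_set (\<lambda>j. fst x j - fst y j) I)"
      using E.integrable_d by (intro AE_I2) simp
  qed
  have "gini_mean_diff I (group_law E.Q I)
      = (\<integral>z. ?f z \<partial>distr (E.Q \<Otimes>\<^sub>M E.Q) (vec_space I \<Otimes>\<^sub>M vec_space I) (\<lambda>(x, y). (?r x, ?r y)))"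
    unfolding gini_mean_diff_def group_law_def
    by (subst pair_measure_distr[OF r r]) (rule R.sigma_finite_measure_axioms, rule refl)
  also have "\<dots> = (\<integral>z. ?f (case z of (x, y) \<Rightarrow> (?r x, ?r y)) \<partial>(E.Q \<Otimes>\<^sub>M E.Q))"
    by (rule integral_distr) measurable
  \<comment> \<open>\<open>L2_set _ I\<close> reads only coordinates in \<open>I\<close>, so the
    restriction disappears.\<close>
  also have "\<dots> = (\<integral>z. (case z of (x, y) \<Rightarrow> L2_set (\<lambda>j. fst x j - fst y j) I) \<partial>(E.Q \<Otimes>\<^sub>M E.Q))"
    by (intro Bochner_Integration.integral_cong refl) (auto split: prod.splits intro!: L2_set_cong)
  also have "\<dots> = E.\<Delta>"
    using QQ.integral_fst'[OF int] by (simp add: E.\<Delta>_def E.g_def[abs_def])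
  finally show ?thesis by (simp add: E.Q_def)
qed

text \<open>Conditioning on a sure event changes nothing; the full sample thus becomes the case
  \<open>A = space D\<close> of the bounds for classes.\<close>

lemma uniform_measure_space: "uniform_measure D (space D) = D"
  by (rule measure_eqI) (auto simp: emeasure_space_1 Int_absorb1 sets.sets_into_space divide_ennreal_def)

lemma sum_class_prob: "(\<Sum>k\<in>C. class_prob D k) = 1"
proof -
  have "(\<Sum>k\<in>C. class_prob D k) = prob (\<Union>k\<in>C. class_event D k)"
    unfolding class_prob_def
    by (rule finite_measure_finite_Union[symmetric])
       (auto simp: finite_C class_event_sets disjoint_family_on_def class_event_def)
  also have "(\<Union>k\<in>C. class_event D k) = space D" by (auto simp: class_event_def space_D)
  finally show ?thesis by (simp add: prob_space)
qed

text \<open>The law of a group is the mixture of its conditional laws.\<close>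
lemma group_law_mgf:
  assumes I: "I \<subseteq> {..<p}" and pos: "\<And>k. k \<in> C \<Longrightarrow> 0 < class_prob D k" and b: "0 \<le> b"
    and mgf: "\<And>k. k \<in> C \<Longrightarrow> (\<integral>\<^sup>+x. ennreal (exp (s * L2_set x I)) \<partial>cond_group_law D I k) \<le> ennreal b"
  shows "(\<integral>\<^sup>+x. ennreal (exp (s * L2_set x I)) \<partial>group_law D I) \<le> ennreal b"
proof -
  have [measurable]: "(\<lambda>z. fst z j) \<in> borel_measurable D" if "j \<in> I" for j
    using that I by (intro coord_meas) auto
  let ?f = "\<lambda>z :: (nat \<Rightarrow> real) \<times> 'c. ennreal (exp (s * L2_set (fst z) I))"
  have f[measurable]: "?f \<in> borel_measurable D" unfolding L2_set_def by measurable
  have one: "(\<integral>\<^sup>+z. ?f z * indicator (class_event D k) z \<partial>D) \<le> ennreal (b * class_prob D k)" if k: "k \<in> C" for k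
  proof -
    let ?I = "\<integral>\<^sup>+z. ?f z * indicator (class_event D k) z \<partial>D" and ?e = "emeasure D (class_event D k)"
    have e: "?e = ennreal (class_prob D k)" by (simp add: emeasure_eq_measure class_prob_def)
    have "?I = ?I / ?e * ?e"
      using pos[OF k] e by (simp add: ennreal_divide_times ennreal_divide_self)
    also have "?I / ?e = (\<integral>\<^sup>+x. ennreal (exp (s * L2_set x I)) \<partial>cond_group_law D I k)"
      using k unfolding cond_group_law_def
      by (subst nn_integral_group_law[OF I]) (auto simp: nn_integral_uniform_measure[OF f class_event_sets[OF k]])
    also have "\<dots> * ?e \<le> ennreal b * ?e" by (intro mult_right_mono mgf k) simp
    finally show ?thesis using b pos[OF k] by (simp add: e ennreal_mult)
  qed
  have "(\<integral>\<^sup>+x. ennreal (exp (s * L2_set x I)) \<partial>group_law D I) = (\<integral>\<^sup>+z. ?f z \<partial>D)"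
    by (rule nn_integral_group_law[OF I refl])
  also have "\<dots> = (\<integral>\<^sup>+z. (\<Sum>k\<in>C. ?f z * indicator (class_event D k) z) \<partial>D)"
  proof (rule nn_integral_cong)
    fix z assume z: "z \<in> space D"
    have "(\<Sum>k\<in>C. ?f z * indicator (class_event D k) z) = (\<Sum>k\<in>C. if k = snd z then ?f z else 0)"
      using z by (intro sum.cong refl) (auto simp: class_event_def indicator_def)
    also have "\<dots> = ?f z" using z finite_C by (auto simp: space_D)
    finally show "?f z = (\<Sum>k\<in>C. ?f z * indicator (class_event D k) z)" ..
  qed
  also have "\<dots> = (\<Sum>k\<in>C. \<integral>\<^sup>+z. ?f z * indicator (class_event D k) z \<partial>D)"
    by (rule nn_integral_sum) (use class_event_sets in measurable)
  also have "\<dots> \<le> (\<Sum>k\<in>C. ennreal (b * class_prob D k))" by (rule sum_mono[OF one])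
  also have "\<dots> = ennreal (\<Sum>k\<in>C. b * class_prob D k)"
    by (rule sum_ennreal) (use b in \<open>auto simp: class_prob_def\<close>)
  also have "(\<Sum>k\<in>C. b * class_prob D k) = b"
    by (simp add: sum_distrib_left[symmetric] sum_class_prob)
  finally show ?thesis .
qed

end

section \<open>Simultaneous deviation bounds for the sample correlations\<close>

context grouped_law
begin

text \<open>The lower bound \<open>q\<close> replaces \<open>prob A\<close> in the exponent, which
  only weakens the estimate and gives all classes the same rate.\<close>

lemma event_deviation:
  fixes n :: nat and q :: real
  assumes I: "I \<subseteq> {..<p}" and A: "A \<in> events" "q \<le> prob A" and q: "0 < q" "4 \<le> n * q"
    and s: "0 < s" and eps: "0 < \<epsilon>" "\<epsilon> \<le> 1 / 4"
    and mgf: "(\<integral>\<^sup>+x. ennreal (exp (s * L2_set x I)) \<partial>group_law (uniform_measure D A) I) \<le> ennreal b"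
  defines "F \<equiv> group_law (uniform_measure D A) I"
  shows "0 \<le> gini_mean_diff I F" "gini_mean_diff I F \<le> 2 * b / s"
    and "\<exists>E \<in> sets (PiM {..<n} (\<lambda>_. D)).
      emeasure (PiM {..<n} (\<lambda>_. D)) E \<le> ennreal (real (2 * n + 4) * exp (- deviation_rate s b \<epsilon> * n * q)) \<and>
      (\<forall>x \<in> space (PiM {..<n} (\<lambda>_. D)) - E.
         \<bar>real (card {i. i < n \<and> x i \<in> A}) / n - prob A\<bar> \<le> \<epsilon> * prob A \<and>
         \<bar>gini_mean_diff_hat I {i. i < n \<and> x i \<in> A} (\<lambda>i. fst (x i)) - gini_mean_diff I F\<bar> \<le> 4 * \<epsilon>)"
proof -
  have ev: "gini_event D A (\<lambda>x y. L2_set (\<lambda>j. fst x j - fst y j) I) (\<lambda>x. L2_set (fst x) I) s b"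
    using A q by (intro gini_eventI I s mgf) auto
  interpret E: gini_event D A "\<lambda>x y. L2_set (\<lambda>j. fst x j - fst y j) I" "\<lambda>x. L2_set (fst x) I" s b
    by (rule ev)
  have F: "gini_mean_diff I F = E.\<Delta>"
    unfolding F_def by (rule gini_mean_diff_eq[OF I ev])
  show "0 \<le> gini_mean_diff I F" "gini_mean_diff I F \<le> 2 * b / s"
    unfolding F by (rule E.\<Delta>_nonneg, rule E.\<Delta>_le)
  obtain E where E: "E \<in> sets (E.sample n)" "\<And>x. x \<in> space (E.sample n) - E \<Longrightarrow> E.typical n \<epsilon> x"
    "emeasure (E.sample n) E \<le> ennreal (real (2 * n + 4) * exp (- deviation_rate s b \<epsilon> * n * prob A))"
    using E.exceptional_set[OF eps(1), of n] by blast
  have nq: "n * q \<le> n * prob A" using A by (intro mult_left_mono) auto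
  have "deviation_rate s b \<epsilon> * (n * q) \<le> deviation_rate s b \<epsilon> * (n * prob A)"
    using deviation_rate_pos[OF s E.b_nonneg eps(1)] by (intro mult_left_mono nq) simp
  then have "real (2 * n + 4) * exp (- deviation_rate s b \<epsilon> * n * prob A)
      \<le> real (2 * n + 4) * exp (- deviation_rate s b \<epsilon> * n * q)"
    by (intro mult_left_mono) (auto simp: mult.assoc)
  note bound = order_trans[OF E(3) ennreal_leI[OF this]]
  have "\<bar>real (card {i. i < n \<and> x i \<in> A}) / n - prob A\<bar> \<le> \<epsilon> * prob A \<and>
         \<bar>gini_mean_diff_hat I {i. i < n \<and> x i \<in> A} (\<lambda>i. fst (x i)) - gini_mean_diff I F\<bar> \<le> 4 * \<epsilon>"
    if "x \<in> space (E.sample n) - E" for x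
    using E.typical_estimates[OF E(2)[OF that] eps] q nq by (simp add: F gini_mean_diff_hat_def)
  then show "\<exists>E \<in> sets (PiM {..<n} (\<lambda>_. D)).
      emeasure (PiM {..<n} (\<lambda>_. D)) E \<le> ennreal (real (2 * n + 4) * exp (- deviation_rate s b \<epsilon> * n * q)) \<and>
      (\<forall>x \<in> space (PiM {..<n} (\<lambda>_. D)) - E.
         \<bar>real (card {i. i < n \<and> x i \<in> A}) / n - prob A\<bar> \<le> \<epsilon> * prob A \<and>
         \<bar>gini_mean_diff_hat I {i. i < n \<and> x i \<in> A} (\<lambda>i. fst (x i)) - gini_mean_diff I F\<bar> \<le> 4 * \<epsilon>)"
    using E(1) bound by blast
qed

end

text \<open>The difference equals \<open>W * (D' - D) / (D * D') - (W' - W) / D'\<close>, and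
  \<open>\<delta> \<le> c / 2\<close> keeps \<open>D'\<close> above \<open>c / 2\<close>.\<close>

lemma abs_quotient_diff_le:
  fixes D D' W W' :: real
  assumes c: "0 < c" "c \<le> D" and D': "\<bar>D' - D\<bar> \<le> \<delta>" "\<delta> \<le> c / 2"
    and W: "0 \<le> W" "W \<le> m" "\<bar>W' - W\<bar> \<le> \<eta>"
  shows "\<bar>(D' - W') / D' - (D - W) / D\<bar> \<le> 2 * m * \<delta> / c\<^sup>2 + 2 * \<eta> / c"
proof -
  have pos: "0 < D" "c / 2 \<le> D'" "0 < D'" using c D' by (auto simp: abs_le_iff)
  have "(D' - W') / D' - (D - W) / D = W * (D' - D) / (D * D') - (W' - W) / D'"
    using pos by (simp add: field_simps)
  also have "\<bar>\<dots>\<bar> \<le> \<bar>W * (D' - D) / (D * D')\<bar> + \<bar>(W' - W) / D'\<bar>" by (rule abs_triangle_ineq4)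
  also have "\<bar>W * (D' - D) / (D * D')\<bar> \<le> m * \<delta> / (c * (c / 2))"
    unfolding abs_divide abs_mult using pos c D' W by (intro frac_le mult_mono) auto
  also have "\<bar>(W' - W) / D'\<bar> \<le> \<eta> / (c / 2)"
    unfolding abs_divide using pos c W by (intro frac_le) auto
  finally show ?thesis by (simp add: power2_eq_square mult_ac)
qed

text \<open>Split each term as \<open>w' * (u' - u) + (w' - w) * u\<close>. The errors of the
  weights are relative and the weights sum to 1, so the bound does not grow with the number of
  classes.\<close>

lemma abs_weighted_sum_diff_le:
  fixes w w' u u' :: "'k \<Rightarrow> real"
  assumes w: "(\<Sum>k\<in>C. w k) = 1" and w': "(\<Sum>k\<in>C. w' k) = 1" "\<And>k. k \<in> C \<Longrightarrow> 0 \<le> w' k"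
    and ww: "\<And>k. k \<in> C \<Longrightarrow> \<bar>w' k - w k\<bar> \<le> \<epsilon> * w k" and u: "\<And>k. k \<in> C \<Longrightarrow> 0 \<le> u k" "\<And>k. k \<in> C \<Longrightarrow> u k \<le> m"
    and uu: "\<And>k. k \<in> C \<Longrightarrow> \<bar>u' k - u k\<bar> \<le> \<delta>"
  shows "\<bar>(\<Sum>k\<in>C. w' k * u' k) - (\<Sum>k\<in>C. w k * u k)\<bar> \<le> \<delta> + \<epsilon> * m"
proof -
  have "(\<Sum>k\<in>C. w' k * u' k) - (\<Sum>k\<in>C. w k * u k) = (\<Sum>k\<in>C. w' k * (u' k - u k) + (w' k - w k) * u k)"
    by (simp add: sum_subtractf[symmetric] algebra_simps)
  also have "\<bar>\<dots>\<bar> \<le> (\<Sum>k\<in>C. \<bar>w' k * (u' k - u k) + (w' k - w k) * u k\<bar>)" by (rule sum_abs)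
  also have "\<dots> \<le> (\<Sum>k\<in>C. w' k * \<delta> + \<epsilon> * w k * m)"
  proof (rule sum_mono)
    fix k assume k: "k \<in> C"
    have "\<bar>w' k * (u' k - u k)\<bar> \<le> w' k * \<delta>"
      using w'(2) uu k by (simp add: abs_mult mult_left_mono)
    moreover have "\<bar>(w' k - w k) * u k\<bar> \<le> \<epsilon> * w k * m"
      unfolding abs_mult using ww[OF k] u[OF k] by (intro mult_mono) auto
    ultimately show "\<bar>w' k * (u' k - u k) + (w' k - w k) * u k\<bar> \<le> w' k * \<delta> + \<epsilon> * w k * m" by linarith
  qed
  also have "\<dots> = \<delta> + \<epsilon> * m"
    using w w'(1) by (simp add: sum.distrib flip: sum_distrib_left sum_distrib_right)
  finally show ?thesis .
qed

text \<open>The factor of \<open>\<epsilon>\<close> in \<open>abs_quotient_diff_le\<close> at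
  \<open>\<delta> = 4 * \<epsilon>\<close> and
  \<open>\<eta> = 4 * \<epsilon> + \<epsilon> * m\<close>.\<close>

definition dcor_const :: "real \<Rightarrow> real \<Rightarrow> real" where
  "dcor_const c m = 8 * m / c\<^sup>2 + (8 + 2 * m) / c"

context grouped_law
begin

text \<open>Union bound over \<open>r\<close> groups and \<open>card C + 1\<close> events, namely
  the classes for the within-class term and the whole space for the denominator. Off the exceptional
  sets all mean differences are within \<open>4 * \<epsilon>\<close>, and
  \<open>8 * \<epsilon> \<le> c\<close> protects the denominator.\<close>

lemma dcor_hat_deviation:
  fixes n r :: nat and q :: real
  assumes G: "\<And>l. l < r \<Longrightarrow> G l \<subseteq> {..<p}" and C: "C \<noteq> {}"
    and q: "0 < q" "4 \<le> n * q" "\<And>k. k \<in> C \<Longrightarrow> q \<le> class_prob D k"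
    and s: "0 < s" and b: "0 \<le> b" and c: "0 < c"
    and eps: "0 < \<epsilon>" "\<epsilon> \<le> 1 / 4" "8 * \<epsilon> \<le> c"
    and mgf: "\<And>l k. l < r \<Longrightarrow> k \<in> C \<Longrightarrow>
        (\<integral>\<^sup>+x. ennreal (exp (s * L2_set x (G l))) \<partial>cond_group_law D (G l) k) \<le> ennreal b"
    and nondeg: "\<And>l. l < r \<Longrightarrow> c \<le> gini_mean_diff (G l) (group_law D (G l))"
  shows "\<exists>E \<in> sets (PiM {..<n} (\<lambda>_. D)).
      emeasure (PiM {..<n} (\<lambda>_. D)) E
        \<le> ennreal (real (r * (card C + 1)) * (real (2 * n + 4) * exp (- deviation_rate s b \<epsilon> * n * q))) \<and>
      (\<forall>x \<in> space (PiM {..<n} (\<lambda>_. D)) - E. \<forall>l<r.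
         \<bar>gini_dcor_hat C n (\<lambda>i. fst (x i)) (\<lambda>i. snd (x i)) (G l) - gini_dcor C D (G l)\<bar>
           \<le> \<epsilon> * dcor_const c (2 * b / s))"
proof -
  let ?P = "PiM {..<n} (\<lambda>_. D)" and ?m = "2 * b / s"
  let ?e = "ennreal (real (2 * n + 4) * exp (- deviation_rate s b \<epsilon> * n * q))"
  \<comment> \<open>\<open>None\<close> stands for the full sample and \<open>Some k\<close> for the
    sample of class \<open>k\<close>.\<close>
  define A where "A a = (case a of None \<Rightarrow> space D | Some k \<Rightarrow> class_event D k)" for a
  define F where "F l a = group_law (uniform_measure D (A a)) (G l)" for l a
  have F: "F l None = group_law D (G l)" "F l (Some k) = cond_group_law D (G l) k" for l k
    by (simp_all add: F_def A_def uniform_measure_space cond_group_law_def)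
  define J where "J = insert None (Some ` C)"
  have J: "finite J" "card J = card C + 1"
    using finite_C by (auto simp: J_def card_insert_if card_image)
  have n: "0 < n" using q by (cases n) auto
  have A: "A a \<in> events" "q \<le> prob (A a)" if "a \<in> J" for a
  proof -
    \<comment> \<open>For the whole space the requirement reads \<open>q \<le> 1\<close>, which
      follows from the bound for any single class.\<close>
    obtain k0 where k0: "k0 \<in> C" using C by auto
    have "q \<le> 1"
      using q(3)[OF k0] unfolding class_prob_def by (rule order_trans) (rule prob_le_1)
    then show "A a \<in> events" "q \<le> prob (A a)"
      using that q(3) by (auto simp: J_def A_def class_event_sets prob_space class_prob_def)
  qed
  have mgfF: "(\<integral>\<^sup>+x. ennreal (exp (s * L2_set x (G l))) \<partial>F l a) \<le> ennreal b" if "l < r" "a \<in> J" for l a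
  proof (cases a)
    case None
    have "(\<integral>\<^sup>+x. ennreal (exp (s * L2_set x (G l))) \<partial>group_law D (G l)) \<le> ennreal b"
      using q(1,3) mgf that(1) by (intro group_law_mgf G b) (auto intro: less_le_trans)
    then show ?thesis by (simp add: None F)
  next
    case (Some k)
    then show ?thesis using that mgf by (auto simp: F J_def)
  qed
  note dev = event_deviation[OF G A q(1,2) s eps(1,2) mgfF[unfolded F_def], folded F_def]
  define ok where "ok l a V \<longleftrightarrow> V \<in> sets ?P \<and> emeasure ?P V \<le> ?e \<and>
      (\<forall>x \<in> space ?P - V.
         \<bar>real (card {i. i < n \<and> x i \<in> A a}) / n - prob (A a)\<bar> \<le> \<epsilon> * prob (A a) \<and>
         \<bar>gini_mean_diff_hat (G l) {i. i < n \<and> x i \<in> A a} (\<lambda>i. fst (x i)) - gini_mean_diff (G l) (F l a)\<bar> \<le> 4 * \<epsilon>)"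
    for l a V
  define E where "E l a = (SOME V. ok l a V)" for l a
  have ok: "ok l a (E l a)" if "l < r" "a \<in> J" for l a
    unfolding E_def by (rule someI_ex) (use dev(3)[OF that(1) that(2) that(2) that] in \<open>unfold ok_def, blast\<close>)
  have E: "\<And>l a. l < r \<Longrightarrow> a \<in> J \<Longrightarrow> E l a \<in> sets ?P"
    "\<And>l a. l < r \<Longrightarrow> a \<in> J \<Longrightarrow> emeasure ?P (E l a) \<le> ?e"
    "\<And>l a x. l < r \<Longrightarrow> a \<in> J \<Longrightarrow> x \<in> space ?P - E l a \<Longrightarrow>
         \<bar>real (card {i. i < n \<and> x i \<in> A a}) / n - prob (A a)\<bar> \<le> \<epsilon> * prob (A a)"
    "\<And>l a x. l < r \<Longrightarrow> a \<in> J \<Longrightarrow> x \<in> space ?P - E l a \<Longrightarrow>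
         \<bar>gini_mean_diff_hat (G l) {i. i < n \<and> x i \<in> A a} (\<lambda>i. fst (x i)) - gini_mean_diff (G l) (F l a)\<bar> \<le> 4 * \<epsilon>"
    using ok unfolding ok_def by blast+
  have m: "0 \<le> gini_mean_diff (G l) (F l a)" "gini_mean_diff (G l) (F l a) \<le> ?m" if "l < r" "a \<in> J" for l a
    using dev(1,2)[OF that(1) that(2) that(2) that] by auto
  define U where "U = (\<Union>(l, a)\<in>{..<r} \<times> J. E l a)"
  show ?thesis
  proof (intro bexI[of _ U] conjI ballI allI impI)
    show "U \<in> sets ?P" unfolding U_def using E(1) J by auto
    have "emeasure ?P U \<le> (\<Sum>i\<in>{..<r} \<times> J. emeasure ?P (case i of (l, a) \<Rightarrow> E l a))"
      unfolding U_def using E(1) J by (intro emeasure_subadditive_finite) auto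
    also have "\<dots> \<le> (\<Sum>i\<in>{..<r} \<times> J. ?e)"
      using E(2) by (intro sum_mono) auto
    also have "\<dots> = ennreal (real (r * (card C + 1)) * (real (2 * n + 4) * exp (- deviation_rate s b \<epsilon> * n * q)))"
      using J by (simp add: card_cartesian_product ennreal_mult ennreal_of_nat_eq_real_of_nat del: of_nat_mult of_nat_add of_nat_Suc)
    finally show "emeasure ?P U \<le> \<dots>" .
    fix x l assume x: "x \<in> space ?P - U" and l: "l < r"
    let ?S = "\<lambda>k. {i. i < n \<and> snd (x i) = k}"
    have xi: "x i \<in> space D" if "i < n" for i
      using x that by (auto simp: space_PiM)
    have N: "{i. i < n \<and> x i \<in> A None} = {..<n}" using xi by (auto simp: A_def)
    have S: "{i. i < n \<and> x i \<in> A (Some k)} = ?S k" for k using xi by (auto simp: A_def class_event_def)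
    have xE: "x \<in> space ?P - E l a" if "a \<in> J" for a using x l that by (auto simp: U_def)
    have NJ: "None \<in> J" and SJ: "\<And>k. k \<in> C \<Longrightarrow> Some k \<in> J" by (auto simp: J_def)
    have p: "prob (A (Some k)) = class_prob D k" for k by (simp add: A_def class_prob_def)
    have w': "(\<Sum>k\<in>C. real (card (?S k)) / n) = 1"
    proof -
      have "(\<Sum>k\<in>C. card (?S k)) = card (\<Union>k\<in>C. ?S k)"
        using finite_C by (intro card_UN_disjoint[symmetric]) auto
      also have "(\<Union>k\<in>C. ?S k) = {..<n}" using xi by (auto simp: space_D mem_Times_iff)
      finally have "(\<Sum>k\<in>C. real (card (?S k))) = n" by (simp flip: of_nat_sum)
      then show ?thesis using n by (simp flip: sum_divide_distrib)
    qed
    have W: "\<bar>(\<Sum>k\<in>C. real (card (?S k)) / n * gini_mean_diff_hat (G l) (?S k) (\<lambda>i. fst (x i)))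
        - (\<Sum>k\<in>C. class_prob D k * gini_mean_diff (G l) (cond_group_law D (G l) k))\<bar> \<le> 4 * \<epsilon> + \<epsilon> * ?m"
      using E(3,4)[OF l SJ xE[OF SJ]] m[OF l SJ]
      by (intro abs_weighted_sum_diff_le sum_class_prob w') (auto simp: F p S)
    have W0: "0 \<le> (\<Sum>k\<in>C. class_prob D k * gini_mean_diff (G l) (cond_group_law D (G l) k))"
      using m[OF l SJ] by (intro sum_nonneg mult_nonneg_nonneg) (auto simp: F class_prob_def)
    have "(\<Sum>k\<in>C. class_prob D k * gini_mean_diff (G l) (cond_group_law D (G l) k)) \<le> (\<Sum>k\<in>C. class_prob D k * ?m)"
      using m[OF l SJ] by (intro sum_mono mult_left_mono) (auto simp: F class_prob_def)
    also have "\<dots> = ?m" using sum_class_prob by (simp flip: sum_distrib_right sum_divide_distrib)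
    finally have W1: "(\<Sum>k\<in>C. class_prob D k * gini_mean_diff (G l) (cond_group_law D (G l) k)) \<le> ?m" .
    have "\<bar>gini_dcor_hat C n (\<lambda>i. fst (x i)) (\<lambda>i. snd (x i)) (G l) - gini_dcor C D (G l)\<bar>
        \<le> 2 * ?m * (4 * \<epsilon>) / c\<^sup>2 + 2 * (4 * \<epsilon> + \<epsilon> * ?m) / c"
      unfolding gini_dcor_hat_def gini_dcor_def
      using E(4)[OF l NJ xE[OF NJ]] c eps(3) nondeg[OF l] W W0 W1
      by (intro abs_quotient_diff_le) (auto simp: F N)
    also have "\<dots> = \<epsilon> * dcor_const c ?m"
      unfolding dcor_const_def distrib_left by (simp add: add_divide_distrib distrib_left mult_ac)
    finally show "\<bar>gini_dcor_hat C n (\<lambda>i. fst (x i)) (\<lambda>i. snd (x i)) (G l) - gini_dcor C D (G l)\<bar>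
        \<le> \<epsilon> * dcor_const c ?m" .
  qed
qed

end

subsection \<open>Asymptotics and the main result\<close>

text \<open>Moving both values of a pair by at most \<open>\<delta>\<close> cannot reverse an order
  with margin above \<open>2 * \<delta>\<close>. Arguing pair by pair also covers an empty
  \<open>A\<close> or \<open>B\<close>.\<close>

lemma gap_nonneg_if_close:
  assumes gap: "ereal (2 * \<delta>) < gap A B f"
    and close: "\<And>l. l \<in> A \<union> B \<Longrightarrow> \<bar>f' l - f l\<bar> \<le> \<delta>"
  shows "0 \<le> gap A B f'"
proof -
  have "f' l' \<le> f' l" if "l \<in> A" "l' \<in> B" for l l'
  proof -
    have "gap A B f \<le> ereal (f l) - ereal (f l')"
      unfolding gap_def using that by (intro ereal_minus_mono INF_lower SUP_upper)
    then have "ereal (2 * \<delta>) < ereal (f l - f l')" using less_le_trans[OF gap, of "ereal (f l - f l')"] by simp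
    then show ?thesis using close[of l] close[of l'] that by (simp add: abs_le_iff)
  qed
  then have "(SUP l\<in>B. ereal (f' l)) \<le> (INF l\<in>A. ereal (f' l))"
    by (intro SUP_least INF_greatest) simp
  then show ?thesis unfolding gap_def by (rule ereal_diff_positive)
qed

text \<open>For \<open>\<alpha> \<le> 1\<close> the rate \<open>n powr \<alpha>\<close> is at most
  \<open>n\<close>; the free \<open>\<delta>\<close> is later a fraction of the Chernoff
  rate.\<close>

lemma eventually_mult_ln_le:
  fixes K x :: "nat \<Rightarrow> nat" and \<alpha> \<delta> :: real
  assumes rate: "(\<lambda>n. real (K n) * ln (real (x n)) / real n powr \<alpha>) \<in> o(\<lambda>_. 1)"
    and \<alpha>: "\<alpha> \<le> 1" and \<delta>: "0 < \<delta>"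
  shows "\<forall>\<^sub>F n in sequentially. real (K n) * ln (real (x n)) \<le> \<delta> * real n"
proof -
  have "\<forall>\<^sub>F n in sequentially. norm (real (K n) * ln (real (x n)) / real n powr \<alpha>) \<le> \<delta> * norm (1 :: real)"
    by (rule landau_o.smallD[OF rate \<delta>])
  then show ?thesis using eventually_ge_at_top[of 1]
  proof eventually_elim
    case (elim n)
    have "real n powr \<alpha> \<le> real n" using elim powr_mono[OF \<alpha>, of "real n"] by simp
    moreover have "real (K n) * ln (real (x n)) \<le> \<delta> * real n powr \<alpha>"
      using elim by (simp add: abs_le_iff field_simps)
    ultimately show ?case using \<delta> by (meson mult_left_mono less_imp_le order_trans)
  qed
qed

text \<open>This lets the condition on \<open>ln (p n)\<close> control the number of groups in the
  union bound.\<close>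

lemma card_disjoint_cover_le:
  assumes "disjoint_family_on G {..<r}" "(\<Union>l<r. G l) = {..<p}" "\<forall>l<r. G l \<noteq> {}"
  shows "r \<le> (p :: nat)"
proof -
  have fin: "finite (G l)" if "l < r" for l
    using assms(2) that by (intro finite_subset[of "G l" "{..<p}"]) auto
  have "r = (\<Sum>l<r. 1)" by simp
  also have "\<dots> \<le> (\<Sum>l<r. card (G l))"
    using assms(3) fin by (intro sum_mono) (auto simp: Suc_le_eq card_gt_0_iff)
  also have "\<dots> = card (\<Union>l<r. G l)"
    using assms(1) fin by (intro card_UN_disjoint[symmetric]) (auto simp: disjoint_family_on_def)
  finally show ?thesis using assms(2) by simp
qed

text \<open>With \<open>Z = a * n / K n\<close>, one half of the exponent \<open>Z\<close> absorbs
  the number of groups and the other half exceeds \<open>n ^ 6\<close>: four powers for the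
  polynomial factor and two for summability.\<close>

lemma eventually_union_bound_le:
  fixes K p r :: "nat \<Rightarrow> nat" and \<alpha> a :: real
  assumes rate_n: "(\<lambda>n. real (K n) * ln (real n) / real n powr \<alpha>) \<in> o(\<lambda>_. 1)"
    and rate_p: "(\<lambda>n. real (K n) * ln (real (p n)) / real n powr \<alpha>) \<in> o(\<lambda>_. 1)"
    and \<alpha>: "\<alpha> \<le> 1" and a: "0 < a"
    and K: "\<And>n. 1 \<le> n \<Longrightarrow> 0 < K n" and r: "\<And>n. 1 \<le> n \<Longrightarrow> r n \<le> p n"
  shows "\<forall>\<^sub>F n in sequentially.
    real (r n * (K n + 1)) * (real (2 * n + 4) * exp (- a * n / K n)) \<le> 1 / real n ^ 2"
proof -
  \<comment> \<open>The fraction 1/12 gives \<open>6 * ln n \<le> Z / 2\<close>.\<close>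
  have a12: "0 < a / 12" using a by simp
  have "\<forall>\<^sub>F n in sequentially. 1 \<le> ln (real n)"
    using filterlim_compose[OF ln_at_top filterlim_real_sequentially] by (simp add: filterlim_at_top)
  then show ?thesis
    using eventually_ge_at_top[of 4] eventually_mult_ln_le[OF rate_n \<alpha> a12]
      eventually_mult_ln_le[OF rate_n \<alpha> zero_less_one] eventually_mult_ln_le[OF rate_p \<alpha> half_gt_zero[OF a]]
  proof (eventually_elim)
    case (elim n)
    define Z where "Z = a * n / K n"
    have n: "4 \<le> real n" and K0: "0 < real (K n)" using elim K[of n] by auto
    have "real (K n) * 1 \<le> real (K n) * ln (real n)" using elim by (intro mult_left_mono) auto
    then have Kn: "real (K n) \<le> real n" using elim by simp
    have lnn: "ln (real n) \<le> Z / 12" and lnp: "ln (real (p n)) \<le> Z / 2"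
      using elim K0 a by (auto simp: Z_def field_simps)
    have "real n ^ 6 = exp (6 * ln (real n))"
      using n exp_of_nat_mult[of 6 "ln (real n)"] by simp
    also have "\<dots> \<le> exp (Z / 2)" using lnn by simp
    finally have n6: "real n ^ 6 \<le> exp (Z / 2)" .
    have rp: "real (r n) \<le> exp (Z / 2)"
    \<comment> \<open>If \<open>r n = 0\<close>, then \<open>p n\<close> may be 0 and
      \<open>exp (ln (p n)) = p n\<close> fails.\<close>
    proof (cases "r n = 0")
      case False
      then have "1 \<le> p n" "r n \<le> p n" using r[of n] elim by auto
      then have "real (r n) \<le> exp (ln (real (p n)))" by simp
      also have "\<dots> \<le> exp (Z / 2)" using lnp by simp
      finally show ?thesis .
    qed simp
    \<comment> \<open>Here \<open>K n \<le> n\<close> bounds the first factor; the next step uses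
      \<open>16 \<le> n\<^sup>2\<close>.\<close>
    have "(real (K n) + 1) * (2 * real n + 4) \<le> (2 * real n) * (8 * real n)"
      using Kn n by (intro mult_mono) auto
    also have "\<dots> \<le> real n ^ 4"
      using mult_mono[OF mult_mono[OF n n] order_refl, of "real n ^ 2"] n
      by (simp add: power2_eq_square power4_eq_xxxx mult_ac)
    finally have poly: "(real (K n) + 1) * (2 * real n + 4) \<le> real n ^ 4" .
    have "real (r n * (K n + 1)) * (real (2 * n + 4) * exp (- a * n / K n))
        = real (r n) * ((real (K n) + 1) * (2 * real n + 4)) * exp (- Z)"
      by (simp add: Z_def algebra_simps)
    also have "\<dots> \<le> exp (Z / 2) * real n ^ 4 * exp (- Z)"
      using rp poly by (intro mult_right_mono mult_mono) auto
    also have "\<dots> = real n ^ 4 / exp (Z / 2)"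
    proof -
      have "exp (Z / 2) * exp (- Z) = exp (- (Z / 2))"
        by (subst exp_add[symmetric]) simp
      then have "real n ^ 4 * (exp (Z / 2) * exp (- Z)) = real n ^ 4 * inverse (exp (Z / 2))"
        by (simp only: exp_minus)
      then show ?thesis by (simp only: divide_inverse mult_ac)
    qed
    also have "\<dots> \<le> real n ^ 4 / real n ^ 6"
      using n6 n by (intro divide_left_mono) auto
    also have "\<dots> = 1 / real n ^ 2"
    proof -
      have e: "real n ^ 6 = real n ^ 4 * real n ^ 2" by (simp flip: power_add)
      show ?thesis unfolding e using n by (intro nonzero_divide_mult_cancel_left) simp
    qed
    finally show ?case .
  qed
qed

section \<open>Almost sure separation of active and inactive groups\<close>

theorem theorem2p2:
  fixes M :: "'a measure"
    and p r K :: "nat \<Rightarrow> nat"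
    and C :: "nat \<Rightarrow> 'c set"
    and G :: "nat \<Rightarrow> nat \<Rightarrow> nat set"
    and D :: "nat \<Rightarrow> ((nat \<Rightarrow> real) \<times> 'c) measure"
    and X :: "nat \<Rightarrow> nat \<Rightarrow> 'a \<Rightarrow> nat \<Rightarrow> real"
    and Y :: "nat \<Rightarrow> nat \<Rightarrow> 'a \<Rightarrow> 'c"
    and c c\<^sub>1 c\<^sub>2 c\<^sub>3 c\<^sub>4 s\<^sub>0 \<tau> \<kappa> \<alpha> \<beta> :: real
  assumes prob: "prob_space M"
    and classes: "\<And>n. n \<ge> 1 \<Longrightarrow> finite (C n) \<and> card (C n) = K n \<and> K n \<ge> 2"
    and groups: "\<And>n. n \<ge> 1 \<Longrightarrow> disjoint_family_on (G n) {..<r n} \<and>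
                   (\<Union>l<r n. G n l) = {..<p n} \<and> (\<forall>l<r n. G n l \<noteq> {})"
    and sample_indep: "\<And>n. n \<ge> 1 \<Longrightarrow>
          prob_space.indep_vars M (\<lambda>_. obs_space (p n) (C n)) (\<lambda>i \<omega>. (X n i \<omega>, Y n i \<omega>)) {..<n}"
    and sample_law: "\<And>n i. i < n \<Longrightarrow>
          distr M (obs_space (p n) (C n)) (\<lambda>\<omega>. (X n i \<omega>, Y n i \<omega>)) = D n"
    and class_pos: "\<And>n k. n \<ge> 1 \<Longrightarrow> k \<in> C n \<Longrightarrow> class_prob (D n) k > 0"
    (* the denominators Delta_l of the correlations stay away from 0, uniformly in n and l *)
    and nondegenerate: "c\<^sub>4 > 0"
          "\<And>n l. n \<ge> 1 \<Longrightarrow> l < r n \<Longrightarrow> c\<^sub>4 \<le> gini_mean_diff (G n l) (group_law (D n) (G n l))"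
    and C1: "c\<^sub>1 > 0" "c\<^sub>2 > 0" "\<tau> \<ge> 0"
          "\<And>n. n \<ge> 1 \<Longrightarrow> c\<^sub>1 / real (K n) \<le> (MIN k\<in>C n. class_prob (D n) k)"
          "\<And>n. n \<ge> 1 \<Longrightarrow> (MAX k\<in>C n. class_prob (D n) k) \<le> c\<^sub>2 / real (K n)"
          "(\<lambda>n. real (K n)) \<in> O(\<lambda>n. real n powr \<tau>)"
    and C2: "s\<^sub>0 > 0"
          "\<And>s. 0 \<le> s \<Longrightarrow> s \<le> 2 * s\<^sub>0 \<Longrightarrow>
             (SUP n\<in>{1..}. SUP l\<in>{..<r n}. SUP k\<in>C n.
                \<integral>\<^sup>+x. ennreal (exp (s * L2_set x (G n l))) \<partial>cond_group_law (D n) (G n l) k) < \<infinity>"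
    and C3: "c > 0" "0 \<le> \<kappa>" "\<kappa> < 1 / 2"
          "\<And>n l. n \<ge> 1 \<Longrightarrow> l \<in> active_set (p n) (r n) (C n) (G n) (D n) \<Longrightarrow>
             2 * c * real n powr (- \<kappa>) \<le> gini_dcor (C n) (D n) (G n l)"
    and C4: "c\<^sub>3 > 0"
          "liminf (\<lambda>n. gap (active_set (p n) (r n) (C n) (G n) (D n))
                           (inactive_set (p n) (r n) (C n) (G n) (D n))
                           (\<lambda>l. gini_dcor (C n) (D n) (G n l))) \<ge> ereal c\<^sub>3"
    and beta: "0 < \<beta>" "\<beta> < 1 / 2 - \<kappa>"
    and alpha: "\<alpha> = Min {1 - 2 * \<beta> + \<tau>, \<beta> + \<tau>, 1}"
    and rate_n: "(\<lambda>n. real (K n) * ln (real n) / real n powr \<alpha>) \<in> o(\<lambda>_. 1)"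
    and rate_p: "(\<lambda>n. real (K n) * ln (real (p n)) / real n powr \<alpha>) \<in> o(\<lambda>_. 1)"
  shows "AE \<omega> in M.
           liminf (\<lambda>n. gap (active_set (p n) (r n) (C n) (G n) (D n))
                           (inactive_set (p n) (r n) (C n) (G n) (D n))
                           (\<lambda>l. gini_dcor_hat (C n) n (\<lambda>i. X n i \<omega>) (\<lambda>i. Y n i \<omega>) (G n l))) \<ge> 0"
proof -
  interpret prob_space M by (rule prob)
  \<comment> \<open>The largest exponent allowed by \<open>C2\<close>; the finite supremum there
    becomes a single real bound \<open>b\<close> for all \<open>n\<close>, groups and
    classes.\<close>
  define s where "s = 2 * s\<^sub>0"
  define b where "b = enn2real (SUP n\<in>{1..}. SUP l\<in>{..<r n}. SUP k\<in>C n.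
      \<integral>\<^sup>+x. ennreal (exp (s * L2_set x (G n l))) \<partial>cond_group_law (D n) (G n l) k)"
  have s: "0 < s" using C2(1) by (simp add: s_def)
  have b: "0 \<le> b" by (simp add: b_def)
  have mgf: "(\<integral>\<^sup>+x. ennreal (exp (s * L2_set x (G n l))) \<partial>cond_group_law (D n) (G n l) k) \<le> ennreal b"
    if "1 \<le> n" "l < r n" "k \<in> C n" for n l k
  proof -
    have "(SUP n\<in>{1..}. SUP l\<in>{..<r n}. SUP k\<in>C n.
        \<integral>\<^sup>+x. ennreal (exp (s * L2_set x (G n l))) \<partial>cond_group_law (D n) (G n l) k) < \<infinity>"
      using C2 by (intro C2(2)) (auto simp: s_def)
    then have "ennreal b = (SUP n\<in>{1..}. SUP l\<in>{..<r n}. SUP k\<in>C n.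
        \<integral>\<^sup>+x. ennreal (exp (s * L2_set x (G n l))) \<partial>cond_group_law (D n) (G n l) k)"
      unfolding b_def by (intro ennreal_enn2real) simp
    also have "\<dots> \<ge> (\<integral>\<^sup>+x. ennreal (exp (s * L2_set x (G n l))) \<partial>cond_group_law (D n) (G n l) k)"
      using that by (intro SUP_upper2[of n] SUP_upper2[of l] SUP_upper2[of k]) auto
    finally show ?thesis .
  qed
  define L where "L = dcor_const c\<^sub>4 (2 * b / s)"
  have L: "0 \<le> L"
    using nondegenerate(1) b s by (auto simp: L_def dcor_const_def intro!: add_nonneg_nonneg)
  \<comment> \<open>The first two entries are the requirements of \<open>dcor_hat_deviation\<close>.
    The third makes the error \<open>\<epsilon> * L\<close> of each correlation smaller than
    \<open>c\<^sub>3 / 4\<close>; using \<open>L + 1\<close> gives a positive denominator from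
    \<open>0 \<le> L\<close>.\<close>
  define \<epsilon> where "\<epsilon> = min (1 / 4) (min (c\<^sub>4 / 8) (c\<^sub>3 / (4 * (L + 1))))"
  have eps_le: "\<epsilon> \<le> 1 / 4" "\<epsilon> \<le> c\<^sub>4 / 8" "\<epsilon> \<le> c\<^sub>3 / (4 * (L + 1))"
    unfolding \<epsilon>_def by linarith+
  have "0 < \<epsilon>" using nondegenerate(1) C4(1) L by (auto simp: \<epsilon>_def intro!: divide_pos_pos)
  with eps_le have eps: "0 < \<epsilon>" "\<epsilon> \<le> 1 / 4" "8 * \<epsilon> \<le> c\<^sub>4" by auto
  have "\<epsilon> * (4 * (L + 1)) \<le> c\<^sub>3" using L eps_le(3) by (simp add: pos_le_divide_eq)
  then have epsL: "4 * (\<epsilon> * L) < c\<^sub>3" using eps by (simp add: algebra_simps)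
  define \<eta> where "\<eta> = deviation_rate s b \<epsilon>"
  have \<eta>: "0 < \<eta>" unfolding \<eta>_def by (intro deviation_rate_pos s b eps)
  have \<alpha>: "\<alpha> \<le> 1" unfolding alpha by (intro Min_le) auto
  have K: "0 < K n" if "1 \<le> n" for n using classes[OF that] by simp
  define Z where "Z n \<omega> = (\<lambda>i\<in>{..<n}. (X n i \<omega>, Y n i \<omega>))" for n \<omega>
  define err where "err n l \<omega> = \<bar>gini_dcor_hat (C n) n (\<lambda>i. X n i \<omega>) (\<lambda>i. Y n i \<omega>) (G n l)
      - gini_dcor (C n) (D n) (G n l)\<bar>" for n l \<omega>
  define P where "P n = real (r n * (K n + 1)) * (real (2 * n + 4) * exp (- (\<eta> * c\<^sub>1) * n / K n))" for n
  define ok where "ok n B \<longleftrightarrow> B \<in> events \<and> prob B \<le> P n \<and>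
      (\<forall>\<omega> \<in> space M - B. \<forall>l<r n. err n l \<omega> \<le> \<epsilon> * L)" for n B
  have ex_ok: "\<exists>B. ok n B"
    if n: "1 \<le> n" and large: "4 \<le> n * (c\<^sub>1 / K n)" for n
  proof -
    have rv: "(\<lambda>\<omega>. (X n i \<omega>, Y n i \<omega>)) \<in> measurable M (obs_space (p n) (C n))" if "i < n" for i
      using sample_indep[OF n] that by (auto simp: indep_vars_def)
    have law: "distr M (obs_space (p n) (C n)) (\<lambda>\<omega>. (X n i \<omega>, Y n i \<omega>)) = D n" if "i < n" for i
      using sample_law[OF that] .
    have n0: "0 < n" using n by simp
    interpret Dn: prob_space "D n"
      using prob_space_distr[OF rv[OF n0]] unfolding law[OF n0] .
    interpret Dn: grouped_law "D n" "p n" "C n"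
    proof
      show "sets (D n) = sets (obs_space (p n) (C n))" unfolding law[OF n0, symmetric] by (rule sets_distr)
      show "finite (C n)" using classes[OF n] by blast
    qed
    \<comment> \<open>Independence and the common law \<open>D n\<close> make the sample distributed
      as the product measure, so exceptional sets can be pulled back to \<open>M\<close>.\<close>
    have "distr M (PiM {..<n} (\<lambda>_. obs_space (p n) (C n))) (Z n)
        = PiM {..<n} (\<lambda>i. distr M (obs_space (p n) (C n)) (\<lambda>\<omega>. (X n i \<omega>, Y n i \<omega>)))"
      unfolding Z_def using n0 rv
      by (intro iffD1[OF indep_vars_iff_distr_eq_PiM' sample_indep[OF n]]) auto
    also have "\<dots> = PiM {..<n} (\<lambda>_. D n)" by (intro PiM_cong refl law) simp
    finally have Z_law: "distr M (PiM {..<n} (\<lambda>_. obs_space (p n) (C n))) (Z n) = PiM {..<n} (\<lambda>_. D n)" .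
    have Z: "Z n \<in> measurable M (PiM {..<n} (\<lambda>_. obs_space (p n) (C n)))"
      unfolding Z_def using rv by (intro measurable_restrict) auto
    have sets_eq: "sets (PiM {..<n} (\<lambda>_. D n)) = sets (PiM {..<n} (\<lambda>_. obs_space (p n) (C n)))"
      unfolding Z_law[symmetric] by simp
    have q: "c\<^sub>1 / K n \<le> class_prob (D n) k" if "k \<in> C n" for k
      using C1(4)[OF n] classes[OF n] that by (auto intro: order_trans Min_le)
    have "\<exists>E \<in> sets (PiM {..<n} (\<lambda>_. D n)).
      emeasure (PiM {..<n} (\<lambda>_. D n)) E
        \<le> ennreal (real (r n * (card (C n) + 1)) * (real (2 * n + 4) * exp (- deviation_rate s b \<epsilon> * n * (c\<^sub>1 / K n)))) \<and>
      (\<forall>x \<in> space (PiM {..<n} (\<lambda>_. D n)) - E. \<forall>l<r n.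
         \<bar>gini_dcor_hat (C n) n (\<lambda>i. fst (x i)) (\<lambda>i. snd (x i)) (G n l) - gini_dcor (C n) (D n) (G n l)\<bar>
           \<le> \<epsilon> * dcor_const c\<^sub>4 (2 * b / s))"
    proof (rule Dn.dcor_hat_deviation)
      show "G n l \<subseteq> {..<p n}" if "l < r n" for l using groups[OF n] that by blast
      show "C n \<noteq> {}" using classes[OF n] by auto
      show "0 < c\<^sub>1 / K n" using C1(1) K[OF n] by simp
    qed (fact large q s b nondegenerate(1) eps mgf[OF n] nondegenerate(2)[OF n])+
    then obtain E where E: "E \<in> sets (PiM {..<n} (\<lambda>_. D n))" "emeasure (PiM {..<n} (\<lambda>_. D n)) E \<le> ennreal (P n)"
      "\<And>x l. x \<in> space (PiM {..<n} (\<lambda>_. D n)) - E \<Longrightarrow> l < r n \<Longrightarrow>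
         \<bar>gini_dcor_hat (C n) n (\<lambda>i. fst (x i)) (\<lambda>i. snd (x i)) (G n l) - gini_dcor (C n) (D n) (G n l)\<bar> \<le> \<epsilon> * L"
      using classes[OF n] by (auto simp: P_def L_def \<eta>_def mult_ac)
    define B where "B = Z n -` E \<inter> space M"
    have B: "B \<in> events" unfolding B_def using Z E(1) sets_eq by (intro measurable_sets) auto
    have "emeasure M B = emeasure (PiM {..<n} (\<lambda>_. D n)) E"
      unfolding B_def Z_law[symmetric] using Z E(1) sets_eq by (intro emeasure_distr[symmetric]) auto
    then have "ennreal (prob B) \<le> ennreal (P n)" using E(2) by (simp add: emeasure_eq_measure)
    then have "prob B \<le> P n" by (subst (asm) ennreal_le_iff) (auto simp: P_def)
    moreover have "err n l \<omega> \<le> \<epsilon> * L" if \<omega>: "\<omega> \<in> space M - B" and l: "l < r n" for \<omega> l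
    proof -
      have "Z n \<omega> \<in> space (PiM {..<n} (\<lambda>_. D n)) - E"
        using measurable_space[OF Z, of \<omega>] \<omega> sets_eq_imp_space_eq[OF sets_eq] by (auto simp: B_def)
      \<comment> \<open>The estimator reads only indices below \<open>n\<close>, so the restriction
        in \<open>Z n\<close> is harmless.\<close>
      moreover have "gini_dcor_hat (C n) n (\<lambda>i. fst (Z n \<omega> i)) (\<lambda>i. snd (Z n \<omega> i)) (G n l)
          = gini_dcor_hat (C n) n (\<lambda>i. X n i \<omega>) (\<lambda>i. Y n i \<omega>) (G n l)"
        by (auto simp: gini_dcor_hat_def gini_mean_diff_hat_def Z_def cong: conj_cong)
      ultimately show ?thesis using E(3)[of "Z n \<omega>" l] l by (simp add: err_def)
    qed
    ultimately show ?thesis using B unfolding ok_def by blast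
  qed
  \<comment> \<open>The empty set is a default for those \<open>n\<close> with too small expected
    classes; by \<open>ev_large\<close> there are only finitely many.\<close>
  define B where "B n = (if 1 \<le> n \<and> 4 \<le> n * (c\<^sub>1 / K n) then SOME B. ok n B else {})" for n
  have ok: "ok n (B n)" if "1 \<le> n \<and> 4 \<le> n * (c\<^sub>1 / K n)" for n
    using someI_ex[OF ex_ok] that by (simp add: B_def)
  have B: "B n \<in> events" for n
    using ok[of n] by (cases "1 \<le> n \<and> 4 \<le> n * (c\<^sub>1 / K n)") (auto simp: ok_def B_def)
  \<comment> \<open>Together with \<open>ln n \<ge> 1\<close>, the fraction
    \<open>c\<^sub>1 / 4\<close> yields \<open>K n \<le> c\<^sub>1 / 4 * n\<close>, which is the
    requirement \<open>4 \<le> n * (c\<^sub>1 / K n)\<close>.\<close>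
  have c14: "0 < c\<^sub>1 / 4" using C1(1) by simp
  have "\<forall>\<^sub>F n in sequentially. 1 \<le> ln (real n)"
    using filterlim_compose[OF ln_at_top filterlim_real_sequentially] by (simp add: filterlim_at_top)
  then have ev_large: "\<forall>\<^sub>F n in sequentially. 1 \<le> n \<and> 4 \<le> n * (c\<^sub>1 / K n)"
    using eventually_ge_at_top[of 1] eventually_mult_ln_le[OF rate_n \<alpha> c14]
  proof eventually_elim
    case (elim n)
    have "real (K n) * 1 \<le> real (K n) * ln (real n)" using elim by (intro mult_left_mono) auto
    then have "real (K n) \<le> c\<^sub>1 / 4 * real n" using elim by simp
    then show ?case using elim K[of n] by (simp add: field_simps)
  qed
  have "\<forall>\<^sub>F n in sequentially. P n \<le> 1 / real n ^ 2"
    unfolding P_def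
  proof (rule eventually_union_bound_le[OF rate_n rate_p \<alpha>])
    show "r n \<le> p n" if "1 \<le> n" for n using groups[OF that] by (intro card_disjoint_cover_le) auto
  qed (use \<eta> C1(1) K in auto)
  then have "\<forall>\<^sub>F n in sequentially. norm (prob (B n)) \<le> 1 / real n ^ 2"
    using ev_large by eventually_elim (use ok in \<open>force simp: ok_def\<close>)
  moreover have "summable (\<lambda>n. 1 / real n ^ 2)"
    using inverse_power_summable[of 2, where 'a=real] by (simp add: inverse_eq_divide)
  ultimately have "summable (\<lambda>n. prob (B n))" by (rule summable_comparison_test_ev)
  \<comment> \<open>The first Borel-Cantelli lemma uses only summability; the samples for different
    \<open>n\<close> may be related in any way.\<close>
  then have "AE \<omega> in M. \<forall>\<^sub>F n in sequentially. \<omega> \<in> space M - B n"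
    by (intro borel_cantelli_AE1 B) (auto simp: emeasure_eq_measure)
  then show ?thesis
  proof eventually_elim
    case (elim \<omega>)
    \<comment> \<open>A number strictly below the lower limit is eventually exceeded by the true
      gap, which then beats twice the estimation error.\<close>
    have "ereal (2 * (\<epsilon> * L)) < ereal c\<^sub>3" using epsL mult_nonneg_nonneg[OF less_imp_le[OF eps(1)] L] by simp
    then have "\<forall>\<^sub>F n in sequentially. ereal (2 * (\<epsilon> * L)) < gap (active_set (p n) (r n) (C n) (G n) (D n))
          (inactive_set (p n) (r n) (C n) (G n) (D n)) (\<lambda>l. gini_dcor (C n) (D n) (G n l))"
      using C4(2) by (simp add: le_Liminf_iff)
    then have "\<forall>\<^sub>F n in sequentially. 0 \<le> gap (active_set (p n) (r n) (C n) (G n) (D n))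
          (inactive_set (p n) (r n) (C n) (G n) (D n))
          (\<lambda>l. gini_dcor_hat (C n) n (\<lambda>i. X n i \<omega>) (\<lambda>i. Y n i \<omega>) (G n l))"
      using elim ev_large
    proof eventually_elim
      case (elim n)
      then have "err n l \<omega> \<le> \<epsilon> * L" if "l < r n" for l
        using ok[of n] that by (auto simp: ok_def)
      with elim(1) show ?case
        by (intro gap_nonneg_if_close) (auto simp: err_def active_set_def inactive_set_def)
    qed
    then show ?case by (rule Liminf_bounded)
  qed
qed

end
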